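(* $n_2(9,3;7)\ge 51>49=\overline{n}_2(9,3;7)$ and $n_2(9,3;10)\ge 76>74=\overline{n}_2(9,3;10)$.
   Context: All dimensions are vector-space dimensions; a hyperplane of $\mathbb{F}_q^r$ is an $(r-1)$-dimensional subspace. A projective $h-(n,r,s)_q$ system is a multiset of $n$ subspaces of $\mathbb{F}_q^r$, each of dimension at most $h$, such that each hyperplane contains at most $s$ of these subspaces (counted with multiplicity) and some hyperplane contains exactly $s$ of them. $n_q(r,h;s)$ denotes the maximum $n$ such that a projective $h-(n,r,s)_q$ system exists. Moreover $\overline{n}_q(r,h;s):=n_{q^h}(\lceil r/h\rceil,1;s)$; in particular $\overline{n}_2(9,3;s)=n_8(3,1;s)$. *)

theory Defs
  imports "Jordan_Normal_Form.VS_Connect" "HOL-Library.Z2" "HOL-Library.Multiset"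
    "HOL-Library.Cardinality"
begin

text \<open>
  The finite field with \<open>q\<close> elements is represented by a type of sort \<open>{field, finite}\<close> with
  \<open>q\<close> elements, and \<open>F_q^r\<close> by the library's vector space \<open>module_vec TYPE('a) r\<close>.
\<close>

definition is_subspace :: "nat \<Rightarrow> 'a::{field,finite} vec set \<Rightarrow> bool" where
  "is_subspace r W \<longleftrightarrow> subspace class_ring W (module_vec TYPE('a) r)"

definition sdim :: "nat \<Rightarrow> 'a::{field,finite} vec set \<Rightarrow> nat" where
  "sdim r W = vectorspace.dim class_ring ((module_vec TYPE('a) r)\<lparr>carrier := W\<rparr>)"

definition is_hyperplane :: "nat \<Rightarrow> 'a::{field,finite} vec set \<Rightarrow> bool" where
  "is_hyperplane r H \<longleftrightarrow> is_subspace r H \<and> sdim r H + 1 = r"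

definition contained_count :: "'a vec set multiset \<Rightarrow> 'a vec set \<Rightarrow> nat" where
  "contained_count M H = size (filter_mset (\<lambda>U. U \<subseteq> H) M)"

text \<open>
  \<open>projective_system h n r s M\<close>: \<open>M\<close> is a projective \<open>h-(n,r,s)_q\<close> system,
  where \<open>q\<close> is the cardinality of \<open>'a\<close>.
\<close>

definition projective_system ::
  "nat \<Rightarrow> nat \<Rightarrow> nat \<Rightarrow> nat \<Rightarrow> 'a::{field,finite} vec set multiset \<Rightarrow> bool" where
  "projective_system h n r s M \<longleftrightarrow>
     size M = n \<and>
     (\<forall>U \<in># M. is_subspace r U \<and> sdim r U \<le> h) \<and>
     (\<forall>H. is_hyperplane r H \<longrightarrow> contained_count M H \<le> s) \<and>
     (\<exists>H. is_hyperplane r H \<and> contained_count M H = s)"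

text \<open>
  \<open>n_max TYPE('a) r h s\<close> is \<open>n_q(r,h;s)\<close> for \<open>q = CARD('a)\<close>. The
  \<open>GREATEST\<close> operator is meaningful only where a maximum exists, which is so for \<open>h < r\<close>:
  every member of a system then lies in one of the finitely many hyperplanes.
\<close>

definition n_max :: "'a::{field,finite} itself \<Rightarrow> nat \<Rightarrow> nat \<Rightarrow> nat \<Rightarrow> nat" where
  "n_max _ r h s = (GREATEST n. \<exists>M :: 'a vec set multiset. projective_system h n r s M)"

text \<open>
  The type argument of \<open>n_bar\<close> is the extension field: \<open>n_bar TYPE('k) r h s\<close> is
  the value of overlined \<open>n_q(r,h;s)\<close> for the \<open>q\<close> with \<open>CARD('k) = q ^ h\<close>.
\<close>

definition n_bar :: "'k::{field,finite} itself \<Rightarrow> nat \<Rightarrow> nat \<Rightarrow> nat \<Rightarrow> nat" where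
  "n_bar K r h s = n_max K (nat \<lceil>real r / real h\<rceil>) 1 s"

text \<open>Fields with 2 and with 8 elements exist as types; the latter is \<open>F_2[x]/(x^3+x+1)\<close>.\<close>

lemma UNIV_bit: "(UNIV :: bit set) = {0, 1}"
  by (auto intro: bit.exhaust)

instance bit :: finite
  by standard (simp add: UNIV_bit)

lemma card_bit: "CARD(bit) = 2"
  by (simp add: UNIV_bit)

datatype gf8 = GF8 bit bit bit

instantiation gf8 :: field
begin

definition "0 = GF8 0 0 0"
definition "1 = GF8 1 0 0"

fun plus_gf8 where "GF8 a b c + GF8 a' b' c' = GF8 (a + a') (b + b') (c + c')"
fun times_gf8 where "GF8 a b c * GF8 a' b' c' =
  GF8 (a*a' + (b*c' + c*b')) (a*b' + b*a' + (b*c' + c*b') + c*c') (a*c' + b*b' + c*a' + c*c')"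

definition "- x = (x :: gf8)"
definition "x - y = (x + y :: gf8)"
definition "inverse x = x * x * (x * x) * (x * x :: gf8)"
definition "x div y = x * inverse (y :: gf8)"

instance
proof
  fix x y z :: gf8
  show "x * y * z = x * (y * z)"
    by (cases x; cases y; cases z) (simp only: times_gf8.simps gf8.inject algebra_simps)
  show "x * y = y * x"
    by (cases x; cases y) (simp only: times_gf8.simps gf8.inject algebra_simps)
  show "(x + y) * z = x * z + y * z"
    by (cases x; cases y; cases z) (simp only: times_gf8.simps plus_gf8.simps gf8.inject algebra_simps)
  show "x + y + z = x + (y + z)"
    by (cases x; cases y; cases z) (simp only: plus_gf8.simps gf8.inject algebra_simps)
  show "x + y = y + x"
    by (cases x; cases y) (simp only: plus_gf8.simps gf8.inject algebra_simps)
  show "1 * x = x" by (cases x) (simp add: one_gf8_def)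
  show "0 + x = x" by (cases x) (simp add: zero_gf8_def)
  show "- x + x = 0"
    by (cases x) (simp add: zero_gf8_def uminus_gf8_def)
  show "x - y = x + - y" by (simp add: minus_gf8_def uminus_gf8_def)
  show "(0::gf8) \<noteq> 1" by (simp add: zero_gf8_def one_gf8_def)
  show "x div y = x * inverse y" by (simp add: divide_gf8_def)
  show "inverse (0::gf8) = 0" by (simp add: inverse_gf8_def zero_gf8_def)
  show "x \<noteq> 0 \<Longrightarrow> inverse x * x = 1"
  proof (cases x)
    case (GF8 a b c)
    then show "x \<noteq> 0 \<Longrightarrow> inverse x * x = 1"
      by (cases a; cases b; cases c) (simp_all add: inverse_gf8_def zero_gf8_def one_gf8_def)
  qed
qed

end

lemma UNIV_gf8: "(UNIV :: gf8 set) = (\<lambda>(a, b, c). GF8 a b c) ` UNIV"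
proof -
  have "x \<in> (\<lambda>(a, b, c). GF8 a b c) ` UNIV" for x
    by (cases x) (auto intro: image_eqI[where x = "(_, _, _)"])
  then show ?thesis by blast
qed

instance gf8 :: finite
  by standard (simp add: UNIV_gf8)

lemma card_gf8: "CARD(gf8) = 8"
proof -
  have "CARD(gf8) = CARD(bit \<times> bit \<times> bit)"
    unfolding UNIV_gf8 by (rule card_image) (auto simp: inj_on_def)
  then show ?thesis by (simp add: card_prod card_bit)
qed

end

theory Submission
  imports Defs "HOL-Computational_Algebra.Polynomial" "HOL-Library.Product_Plus"
begin

text \<open>
  The lower bounds over the field with two elements come from explicit systems of planes, which are checked
  against all 511 hyperplanes.

  Over \<open>F_8\<close>, counting on the 9 lines through a point of multiplicity \<open>m\<close> shows that a system of \<open>n\<close> points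
  with at most \<open>s\<close> on each line satisfies \<open>n + 8 m \<le> 9 s\<close>. Hence \<open>n \<ge> 75\<close> and \<open>s = 10\<close> force a set, which is
  impossible as the plane has 73 points; and \<open>n = 50\<close> and \<open>s = 7\<close> force a set whose complement \<open>B\<close> has 23 points
  and meets each line at least twice.

  To exclude \<open>B\<close>, let \<open>e\<close> be the excess over two of the number of points of \<open>B\<close> on a line. Then \<open>\<Sum> e = 61\<close>
  and \<open>\<Sum> e\<^sup>2 = 177\<close>, and the sum over the lines through a point is 13 for points of \<open>B\<close> and 5 for the
  others. For \<open>P \<in> B\<close>, choose coordinates with \<open>P = (0, 0, 1)\<close>. The polynomial \<open>\<Prod> (a x + b y + c)\<close> over the
  points \<open>(a, b, c)\<close> of \<open>B - {P}\<close> has degree 22 and a double zero at every \<open>(x, y)\<close>. Its partial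
  derivatives hence vanish everywhere, which forces the coefficients of \<open>x^15 y^7\<close> and \<open>x^7 y^15\<close> to vanish. In terms of the
  line \<open>l\<close> of excess \<open>d\<close> and the other lines \<open>l_t\<close> through \<open>P\<close>, two coefficients of \<open>\<Prod> (1 + t X)^(e l_t)\<close> vanish.
  This gives \<open>d \<le> 5\<close>, and for \<open>d = 4\<close> and \<open>d = 5\<close> it leaves few possibilities for the other excesses: their sum of
  squares is small, unless two of them are at least 4. The latter occurs at two points of \<open>l\<close> at most, because
  the six lines obtained from three such points would cover too many points of \<open>B\<close>. So the squares of the
  excesses of the lines meeting \<open>l\<close> cannot add up to 177.
\<close>

section \<open>Hyperplanes and projective systems\<close>

definition orth :: "nat \<Rightarrow> 'a::{field,finite} vec \<Rightarrow> 'a vec set" where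
  "orth r w = {v \<in> carrier_vec r. w \<bullet> v = 0}"

abbreviation vspan :: "nat \<Rightarrow> 'a::{field,finite} vec set \<Rightarrow> 'a vec set" where
  "vspan r \<equiv> LinearCombinations.module.span class_ring (module_vec TYPE('a) r)"

lemma finite_carrier_vec: "finite (carrier_vec r :: 'a::finite vec set)"
proof -
  have "carrier_vec r \<subseteq> vec_of_list ` {xs :: 'a list. set xs \<subseteq> UNIV \<and> length xs = r}"
  proof
    fix v :: "'a vec" assume "v \<in> carrier_vec r"
    then show "v \<in> vec_of_list ` {xs :: 'a list. set xs \<subseteq> UNIV \<and> length xs = r}"
      by (intro image_eqI[of _ _ "list_of_vec v"]) (auto simp: vec_list)
  qed
  then show ?thesis by (rule finite_subset) (intro finite_imageI finite_lists_length_eq finite)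
qed

lemma is_subspace_span:
  assumes "S \<subseteq> carrier_vec r"
  shows "is_subspace r (vspan r S)"
proof -
  interpret vec_space "TYPE('a)" r .
  show ?thesis unfolding is_subspace_def using span_is_subspace assms by simp
qed

lemma sdim_span_le:
  fixes S :: "'a::{field,finite} vec set"
  assumes "finite S" "S \<subseteq> carrier_vec r"
  shows "sdim r (vspan r S) \<le> card S"
proof -
  interpret vec_space "TYPE('a)" r .
  interpret W: vectorspace class_ring "vs (span S)"
    using subspace_is_vs span_is_subspace assms(2) by simp
  have sub: "submodule class_ring (span S) V" using span_is_submodule assms(2) by simp
  have S: "S \<subseteq> span S" using in_own_span assms(2) by simp
  have "W.gen_set S" using span_li_not_depend(1)[OF S sub] by simp
  then show ?thesis unfolding sdim_def
    using W.gen_ge_dim[OF assms(1)] S by simp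
qed

lemma span_subset_iff:
  assumes "S \<subseteq> carrier_vec r" "is_subspace r H"
  shows "vspan r S \<subseteq> H \<longleftrightarrow> S \<subseteq> H"
proof -
  interpret vec_space "TYPE('a)" r .
  have "submodule class_ring H V" using assms(2) unfolding is_subspace_def by simp
  moreover have "S \<subseteq> span S" using in_own_span assms(1) by simp
  ultimately show ?thesis using span_is_subset by blast
qed

lemma is_subspace_orth:
  fixes w :: "'a::{field,finite} vec"
  assumes w: "w \<in> carrier_vec r"
  shows "is_subspace r (orth r w)"
proof -
  interpret vec_space "TYPE('a)" r .
  have "submodule class_ring (orth r w) V"
    by (rule submodule.intro)
       (use w in \<open>auto simp: orth_def module_vec_simps scalar_prod_add_distrib class_ring_simps intro: vec_module\<close>)
  then show ?thesis unfolding is_subspace_def subspace_def by (simp add: vec_vs)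
qed

lemma basis_exists:
  fixes W :: "'a::{field,finite} vec set"
  assumes "is_subspace r W"
  obtains b where "finite b" "b \<subseteq> W" "b \<subseteq> carrier_vec r" "card b = sdim r W" "vspan r b = W"
    "\<not> LinearCombinations.module.lin_dep class_ring (module_vec TYPE('a) r) b"
proof -
  interpret vec_space "TYPE('a)" r .
  have W: "subspace class_ring W V" "submodule class_ring W V"
    using assms unfolding is_subspace_def by auto
  interpret W: vectorspace class_ring "vs W" using subspace_is_vs W(1) .
  have Wc: "W \<subseteq> carrier_vec r" using W(2) by (auto simp: submodule_def)
  have fin: "finite W"
    by (rule finite_subset[OF Wc]) (rule finite_carrier_vec)
  have sp: "span W = W"
    using span_is_subset[OF subset_refl W(2)] in_own_span[of W] Wc by auto
  have "W.gen_set W" using span_li_not_depend(1)[OF subset_refl W(2)] sp by simp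
  then have "W.fin_dim" unfolding W.fin_dim_def using fin by auto
  then obtain b where b: "finite b" "W.basis b" using W.finite_basis_exists by auto
  have bW: "b \<subseteq> W" using b(2) unfolding W.basis_def by simp
  show ?thesis
  proof (rule that[OF b(1) bW])
    show "b \<subseteq> carrier_vec r" using bW Wc by blast
    show "card b = sdim r W" unfolding sdim_def using W.dim_basis[OF b] by simp
    show "span b = W" "\<not> lin_dep b" using b(2) span_li_not_depend[OF bW W(2)] unfolding W.basis_def by simp_all
  qed
qed

text \<open>A unit vector \<open>u\<close> with \<open>w \<bullet> u \<noteq> 0\<close> lies outside
  \<open>orth r w\<close>. Adding it to a basis of \<open>orth r w\<close> keeps independence, and
  every vector is a multiple of \<open>u\<close> plus a vector orthogonal to \<open>w\<close>; so
  the dimension is exactly \<open>r - 1\<close>.\<close>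

lemma hyperplane_orth:
  fixes w :: "'a::{field,finite} vec"
  assumes w: "w \<in> carrier_vec r" "w \<noteq> 0\<^sub>v r"
  shows "is_hyperplane r (orth r w)"
proof -
  interpret vec_space "TYPE('a)" r .
  let ?H = "orth r w"
  obtain i where i: "i < r" "w $ i \<noteq> 0" using w by (metis eq_vecI carrier_vecD index_zero_vec)
  define u :: "'a vec" where "u = unit_vec r i"
  have u: "u \<in> carrier_vec r" "w \<bullet> u = w $ i" using i w(1) by (auto simp: u_def)
  obtain b where b: "finite b" "b \<subseteq> ?H" "b \<subseteq> carrier_vec r" "card b = sdim r ?H" "span b = ?H" "\<not> lin_dep b"
    by (rule basis_exists[OF is_subspace_orth[OF w(1)]])
  have uH: "u \<notin> ?H" using u i by (simp add: orth_def)
  have ub: "u \<notin> b" using uH b by auto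
  have "lin_indpt (b \<union> {u})"
    using lin_dep_iff_in_span[of b u] b uH ub u by simp
  then have "card (b \<union> {u}) \<le> dim" using li_le_dim(2)[OF fin_dim, of "b \<union> {u}"] b u by auto
  then have 1: "sdim r ?H + 1 \<le> r" using b(1,4) ub dim_is_n by simp
  have "span (b \<union> {u}) = carrier V"
  proof
    show "span (b \<union> {u}) \<subseteq> carrier V" using span_is_subset2[of "b \<union> {u}"] b u by simp
    have sub: "submodule class_ring (span (b \<union> {u})) V" using span_is_submodule[of "b \<union> {u}"] b u by simp
    have us: "u \<in> span (b \<union> {u})" using in_own_span[of "b \<union> {u}"] b u by auto
    have Hs: "?H \<subseteq> span (b \<union> {u})" using span_is_monotone[of b "b \<union> {u}"] b by auto
    show "carrier V \<subseteq> span (b \<union> {u})"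
    proof
      fix v assume "v \<in> carrier V"
      then have v: "v \<in> carrier_vec r" by simp
      define c where "c = (w \<bullet> v) / (w $ i)"
      have "v - c \<cdot>\<^sub>v u \<in> ?H"
        using v u i w(1) by (simp add: orth_def scalar_prod_minus_distrib[of _ r] c_def)
      then have "v - c \<cdot>\<^sub>v u \<in> span (b \<union> {u})" using Hs by auto
      moreover have "c \<cdot>\<^sub>v u \<in> span (b \<union> {u})"
        using submodule.smult_closed[OF sub, of c u] us by (simp add: class_ring_simps module_vec_simps)
      ultimately have "(v - c \<cdot>\<^sub>v u) + c \<cdot>\<^sub>v u \<in> span (b \<union> {u})"
        using submodule.m_closed[OF sub] by (simp add: module_vec_simps)
      moreover have "(v - c \<cdot>\<^sub>v u) + c \<cdot>\<^sub>v u = v" using v u by auto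
      ultimately show "v \<in> span (b \<union> {u})" by simp
    qed
  qed
  then have "dim \<le> card (b \<union> {u})" using gen_ge_dim[of "b \<union> {u}"] b u by auto
  then have "r \<le> sdim r ?H + 1" using b(1,4) ub dim_is_n by simp
  with 1 show ?thesis unfolding is_hyperplane_def using is_subspace_orth[OF w(1)] by simp
qed

text \<open>The fewer than \<open>r\<close> vectors of a basis of \<open>H\<close>, padded with zero
  rows, form a singular square matrix; \<open>w\<close> is a nonzero vector of its kernel.\<close>

lemma proper_subspace_subset_orth:
  fixes H :: "'a::{field,finite} vec set"
  assumes H: "is_subspace r H" "sdim r H < r"
  obtains w where "w \<in> carrier_vec r" "w \<noteq> 0\<^sub>v r" "H \<subseteq> orth r w"
proof -
  interpret vec_space "TYPE('a)" r .
  obtain b where b: "finite b" "b \<subseteq> carrier_vec r" "card b = sdim r H" "span b = H"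
    by (rule basis_exists[OF H(1)])
  obtain bs where bs: "set bs = b" "length bs = card b"
    using finite_distinct_list[OF b(1)] distinct_card by metis
  have len: "length bs < r" using bs b H by simp
  \<comment> \<open>Row \<open>r - 1\<close> is set to zero outright, so that the determinant
    visibly vanishes; as \<open>length bs < r\<close>, no basis vector is lost.\<close>
  define A where "A = mat\<^sub>r r r (\<lambda>i. if i = r - 1 then 0\<^sub>v r else if i < length bs then bs ! i else 0\<^sub>v r)"
  have A: "A \<in> carrier_mat r r" unfolding A_def by simp
  have "det A = 0"
    unfolding A_def using len bs(1) b(2) by (intro det_row_0) (auto simp: Pi_iff dest: nth_mem)
  then obtain w where w: "w \<in> carrier_vec r" "w \<noteq> 0\<^sub>v r" "A *\<^sub>v w = 0\<^sub>v r"
    using det_0_iff_vec_prod_zero_field[OF A] by auto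
  have "b \<subseteq> orth r w"
  proof
    fix x assume x: "x \<in> b"
    then obtain i where i: "i < length bs" "bs ! i = x" using bs by (metis in_set_conv_nth)
    have xc: "x \<in> carrier_vec r" using x b by auto
    have "row A i = x" unfolding A_def using i len xc by (auto intro: eq_vecI)
    then have "(A *\<^sub>v w) $ i = x \<bullet> w" using i len A by (simp add: mult_mat_vec_def)
    then have "x \<bullet> w = 0" using w(3) i len by simp
    then show "x \<in> orth r w" using xc w(1) by (simp add: orth_def comm_scalar_prod[of w r])
  qed
  then have "H \<subseteq> orth r w" using span_subset_iff[OF b(2) is_subspace_orth[OF w(1)]] b(4) by simp
  then show ?thesis using that w by blast
qed

section \<open>Existence of the maximum, and criteria for projective systems\<close>

lemma sum_strict_mono2_nat:
  fixes f g :: "'b \<Rightarrow> nat"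
  assumes "finite W" "w \<in> W" "f w < g w" "\<And>x. x \<in> W \<Longrightarrow> f x \<le> g x"
  shows "sum f W < sum g W"
  using assms by (intro sum_strict_mono_ex1) auto

lemma size_le_sum_size_filter:
  assumes "finite W" "\<And>x. x \<in># M \<Longrightarrow> \<exists>w\<in>W. P w x"
  shows "size M \<le> (\<Sum>w\<in>W. size (filter_mset (P w) M))"
  using assms(2)
proof (induction M)
  case empty
  then show ?case by simp
next
  case (add x M)
  have "size M \<le> (\<Sum>w\<in>W. size (filter_mset (P w) M))" using add by simp
  moreover obtain w where w: "w \<in> W" "P w x" using add.prems by auto
  have "(\<Sum>w\<in>W. size (filter_mset (P w) M)) < (\<Sum>w\<in>W. size (filter_mset (P w) (add_mset x M)))"
    using w assms(1) by (intro sum_strict_mono2_nat[OF _ w(1)]) auto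
  ultimately show ?case by simp
qed

text \<open>Every member lies in some \<open>orth r w\<close>, and each of these contains at most
  \<open>s\<close> members. This crude bound makes the maximum in \<open>n_max\<close>
  exist.\<close>

lemma projective_system_size_le:
  fixes M :: "'a::{field,finite} vec set multiset"
  assumes M: "projective_system h n r s M" and "h < r"
  shows "n \<le> card (carrier_vec r :: 'a vec set) * s"
proof -
  let ?W = "carrier_vec r - {0\<^sub>v r} :: 'a vec set"
  have "\<exists>w\<in>?W. U \<subseteq> orth r w" if "U \<in># M" for U
  proof -
    have "is_subspace r U" "sdim r U < r" using M that assms(2) unfolding projective_system_def by auto
    then show ?thesis by (rule proper_subspace_subset_orth) auto
  qed
  then have "size M \<le> (\<Sum>w\<in>?W. size (filter_mset (\<lambda>U. U \<subseteq> orth r w) M))"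
    by (intro size_le_sum_size_filter) (simp_all add: finite_carrier_vec)
  also have "\<dots> \<le> (\<Sum>w\<in>?W. s)"
    using M hyperplane_orth unfolding projective_system_def contained_count_def by (intro sum_mono) auto
  also have "\<dots> \<le> card (carrier_vec r :: 'a vec set) * s"
    by (simp add: card_mono finite_carrier_vec)
  finally show ?thesis using M unfolding projective_system_def by simp
qed

lemma n_max_ge:
  fixes M :: "'a::{field,finite} vec set multiset"
  assumes "projective_system h n r s M" "h < r"
  shows "n \<le> n_max TYPE('a) r h s"
  unfolding n_max_def
  by (rule Greatest_le_nat[of _ _ "card (carrier_vec r :: 'a vec set) * s"])
     (use assms projective_system_size_le in blast)+

text \<open>It is enough to test the hyperplanes \<open>orth r w\<close>, since every hyperplane is
  contained in one of them.\<close>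

lemma projective_systemI:
  fixes M :: "'a::{field,finite} vec set multiset"
  assumes "size M = n" "\<And>U. U \<in># M \<Longrightarrow> is_subspace r U \<and> sdim r U \<le> h"
    and le: "\<And>w. w \<in> carrier_vec r \<Longrightarrow> w \<noteq> 0\<^sub>v r \<Longrightarrow> contained_count M (orth r w) \<le> s"
    and eq: "w0 \<in> carrier_vec r" "w0 \<noteq> 0\<^sub>v r" "contained_count M (orth r w0) = s"
  shows "projective_system h n r s M"
  unfolding projective_system_def
proof (intro conjI ballI allI impI)
  fix H :: "'a vec set" assume H: "is_hyperplane r H"
  then have "is_subspace r H" "sdim r H < r" by (auto simp: is_hyperplane_def)
  then obtain w where w: "w \<in> carrier_vec r" "w \<noteq> 0\<^sub>v r" "H \<subseteq> orth r w"
    by (rule proper_subspace_subset_orth)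
  have "contained_count M H \<le> contained_count M (orth r w)"
    unfolding contained_count_def using w(3) by (induction M) auto
  then show "contained_count M H \<le> s" using le[OF w(1,2)] by simp
next
  show "\<exists>H. is_hyperplane r H \<and> contained_count M H = s" using hyperplane_orth[OF eq(1,2)] eq(3) by blast
qed (use assms(1,2) in auto)

text \<open>Prepares the replacement of members by points: a hyperplane that contains
  \<open>u\<close> also contains \<open>U\<close>.\<close>

lemma dim_le_1_generator:
  fixes U :: "'a::{field,finite} vec set"
  assumes "is_subspace r U" "sdim r U \<le> 1" "r \<ge> 1"
  obtains u where "u \<in> carrier_vec r" "u \<noteq> 0\<^sub>v r"
    "\<And>w. w \<in> carrier_vec r \<Longrightarrow> w \<bullet> u = 0 \<Longrightarrow> U \<subseteq> orth r w"
proof -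
  interpret vec_space "TYPE('a)" r .
  obtain b where b: "finite b" "b \<subseteq> carrier_vec r" "card b = sdim r U" "span b = U" "\<not> lin_dep b"
    by (rule basis_exists[OF assms(1)])
  have gen: "U \<subseteq> orth r w" if "w \<in> carrier_vec r" "b \<subseteq> orth r w" for w
    using span_subset_iff[OF b(2) is_subspace_orth[OF that(1)]] b(4) that(2) by simp
  show ?thesis
  proof (cases "b = {}")
    case True
    \<comment> \<open>The zero subspace has no generator; as it lies in every hyperplane, any
      nonzero vector will do.\<close>
    show ?thesis
    proof (rule that[of "unit_vec r 0"])
      show "unit_vec r 0 \<noteq> (0\<^sub>v r :: 'a vec)" using assms(3) by (simp add: unit_vec_nonzero)
      show "unit_vec r 0 \<in> carrier_vec r" by simp
      show "U \<subseteq> orth r w" if w: "w \<in> carrier_vec r" "w \<bullet> unit_vec r 0 = 0" for w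
        using gen[OF w(1)] unfolding True by blast
    qed
  next
    case False
    then have "card b = 1" using b(1,3) assms(2) by (metis One_nat_def Suc_leI card_gt_0_iff le_antisym)
    then obtain u where u: "b = {u}" by (auto simp: card_1_singleton_iff)
    show ?thesis
    proof (rule that[of u])
      show "u \<in> carrier_vec r" using b(2) u by simp
      show "u \<noteq> 0\<^sub>v r" using vs_zero_lin_dep[of b] b(2,5) u by auto
      show "U \<subseteq> orth r w" if "w \<in> carrier_vec r" "w \<bullet> u = 0" for w
        by (rule gen) (use b(2) u that in \<open>auto simp: orth_def\<close>)
    qed
  qed
qed

section \<open>Systems of planes over the field with two elements\<close>

definition bvec :: "bool list \<Rightarrow> 'a::zero_neq_one vec" where
  "bvec bs = vec_of_list (map of_bool bs)"

fun parity :: "bool list \<Rightarrow> bool list \<Rightarrow> bool" where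
  "parity (x # xs) (y # ys) = ((x \<and> y) \<noteq> parity xs ys)"
| "parity _ _ = False"

lemma bvec_carrier [simp]: "length bs = r \<Longrightarrow> bvec bs \<in> carrier_vec r"
  by (auto simp: bvec_def intro!: carrier_vecI)

lemma two_elements:
  assumes "CARD('f::{field,finite}) = 2"
  shows "x = 0 \<or> x = (1::'f)" "(1::'f) + 1 = 0"
proof -
  have "card {0, 1::'f} = CARD('f)" using assms by simp
  then have U: "{0, 1::'f} = UNIV" by (intro card_subset_eq) auto
  then show "x = 0 \<or> x = (1::'f)" by auto
  have "(1::'f) + 1 \<in> {0, 1}" using U by simp
  moreover have "(1::'f) + 1 \<noteq> 1 + 0" unfolding add_left_cancel by simp
  ultimately show "(1::'f) + 1 = 0" by (metis add.right_neutral insertE singletonD)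
qed

lemma bvec_Cons: "bvec (b # bs) = vCons (of_bool b) (bvec bs)"
  by (simp add: bvec_def)

lemma scalar_prod_bvec:
  assumes "CARD('f::{field,finite}) = 2" "length xs = length ys"
  shows "bvec xs \<bullet> bvec ys = (of_bool (parity xs ys) :: 'f)"
  using assms(2)
proof (induction xs ys rule: list_induct2)
  case Nil
  then show ?case by (simp add: bvec_def scalar_prod_def)
next
  case (Cons x xs y ys)
  have "bvec (x # xs) \<bullet> bvec (y # ys) = of_bool x * of_bool y + (bvec xs \<bullet> bvec ys :: 'f)"
    unfolding bvec_Cons by (simp add: scalar_prod_vCons)
  then show ?case using Cons two_elements(2)[OF assms(1)] by auto
qed

lemma obtain_bvec:
  assumes "CARD('f::{field,finite}) = 2" "(w::'f vec) \<in> carrier_vec r"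
  obtains bs where "length bs = r" "w = bvec bs"
proof
  show "length (map (\<lambda>x. x = 1) (list_of_vec w)) = r" using assms(2) by simp
  have "map (of_bool \<circ> (\<lambda>x. x = 1)) (list_of_vec w) = list_of_vec w"
    by (intro map_idI) (use two_elements(1)[OF assms(1)] in auto)
  then show "w = bvec (map (\<lambda>x. x = 1) (list_of_vec w))" by (simp add: bvec_def vec_list)
qed


text \<open>
  An octal digit stands for a vector of \<open>F_2^3\<close>. A list of octal digits is read as the sequence of columns
  of a matrix with three rows, and stands for the space that these rows span.
\<close>

datatype oct = O0 | O1 | O2 | O3 | O4 | O5 | O6 | O7

primrec obits :: "oct \<Rightarrow> bool \<times> bool \<times> bool" where
  "obits O0 = (False, False, False)"
| "obits O1 = (False, False, True)"
| "obits O2 = (False, True, False)"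
| "obits O3 = (False, True, True)"
| "obits O4 = (True, False, False)"
| "obits O5 = (True, False, True)"
| "obits O6 = (True, True, False)"
| "obits O7 = (True, True, True)"

text \<open>Addition in \<open>F_2^3\<close>, given as a table so that evaluation by
  \<open>code_simp\<close> is plain pattern matching.\<close>

primrec oxor :: "oct \<Rightarrow> oct \<Rightarrow> oct" where
  "oxor O0 y = (case y of O0 \<Rightarrow> O0 | O1 \<Rightarrow> O1 | O2 \<Rightarrow> O2 | O3 \<Rightarrow> O3 | O4 \<Rightarrow> O4 | O5 \<Rightarrow> O5 | O6 \<Rightarrow> O6 | O7 \<Rightarrow> O7)"
| "oxor O1 y = (case y of O0 \<Rightarrow> O1 | O1 \<Rightarrow> O0 | O2 \<Rightarrow> O3 | O3 \<Rightarrow> O2 | O4 \<Rightarrow> O5 | O5 \<Rightarrow> O4 | O6 \<Rightarrow> O7 | O7 \<Rightarrow> O6)"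
| "oxor O2 y = (case y of O0 \<Rightarrow> O2 | O1 \<Rightarrow> O3 | O2 \<Rightarrow> O0 | O3 \<Rightarrow> O1 | O4 \<Rightarrow> O6 | O5 \<Rightarrow> O7 | O6 \<Rightarrow> O4 | O7 \<Rightarrow> O5)"
| "oxor O3 y = (case y of O0 \<Rightarrow> O3 | O1 \<Rightarrow> O2 | O2 \<Rightarrow> O1 | O3 \<Rightarrow> O0 | O4 \<Rightarrow> O7 | O5 \<Rightarrow> O6 | O6 \<Rightarrow> O5 | O7 \<Rightarrow> O4)"
| "oxor O4 y = (case y of O0 \<Rightarrow> O4 | O1 \<Rightarrow> O5 | O2 \<Rightarrow> O6 | O3 \<Rightarrow> O7 | O4 \<Rightarrow> O0 | O5 \<Rightarrow> O1 | O6 \<Rightarrow> O2 | O7 \<Rightarrow> O3)"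
| "oxor O5 y = (case y of O0 \<Rightarrow> O5 | O1 \<Rightarrow> O4 | O2 \<Rightarrow> O7 | O3 \<Rightarrow> O6 | O4 \<Rightarrow> O1 | O5 \<Rightarrow> O0 | O6 \<Rightarrow> O3 | O7 \<Rightarrow> O2)"
| "oxor O6 y = (case y of O0 \<Rightarrow> O6 | O1 \<Rightarrow> O7 | O2 \<Rightarrow> O4 | O3 \<Rightarrow> O5 | O4 \<Rightarrow> O2 | O5 \<Rightarrow> O3 | O6 \<Rightarrow> O0 | O7 \<Rightarrow> O1)"
| "oxor O7 y = (case y of O0 \<Rightarrow> O7 | O1 \<Rightarrow> O6 | O2 \<Rightarrow> O5 | O3 \<Rightarrow> O4 | O4 \<Rightarrow> O3 | O5 \<Rightarrow> O2 | O6 \<Rightarrow> O1 | O7 \<Rightarrow> O0)"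

definition plane :: "oct list \<Rightarrow> 'a::{field,finite} vec set" where
  "plane cs = vspan (length cs) {bvec (map (fst \<circ> obits) cs), bvec (map (fst \<circ> snd \<circ> obits) cs),
    bvec (map (snd \<circ> snd \<circ> obits) cs)}"

text \<open>The products of \<open>w\<close> with all three generators at once, packed in one digit:
  it is \<open>O0\<close> exactly if the hyperplane orthogonal to \<open>w\<close> contains the
  plane.\<close>

fun oparity :: "bool list \<Rightarrow> oct list \<Rightarrow> oct" where
  "oparity (x # w) (c # cs) = oxor (oparity w cs) (if x then c else O0)"
| "oparity _ _ = O0"

lemma obits_oxor:
  "fst (obits (oxor x y)) \<longleftrightarrow> fst (obits x) \<noteq> fst (obits y)"
  "fst (snd (obits (oxor x y))) \<longleftrightarrow> fst (snd (obits x)) \<noteq> fst (snd (obits y))"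
  "snd (snd (obits (oxor x y))) \<longleftrightarrow> snd (snd (obits x)) \<noteq> snd (snd (obits y))"
  by (cases x; cases y; simp)+

lemma obits_eq_iff: "x = y \<longleftrightarrow> fst (obits x) = fst (obits y) \<and>
    fst (snd (obits x)) = fst (snd (obits y)) \<and> snd (snd (obits x)) = snd (snd (obits y))"
  by (cases x; cases y; simp)

lemma oxor_O0 [simp]: "oxor x O0 = x" "oxor O0 x = x"
  by (cases x; simp)+

declare oxor.simps [simp del]

lemma oxor_assoc: "oxor (oxor x y) z = oxor x (oxor y z)"
  and oxor_commute: "oxor x y = oxor y x"
  and oxor_left_commute: "oxor x (oxor y z) = oxor y (oxor x z)"
  by (auto simp: obits_eq_iff obits_oxor)

lemma obits_oparity:
  "fst (obits (oparity w cs)) = parity w (map (fst \<circ> obits) cs)"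
  "fst (snd (obits (oparity w cs))) = parity w (map (fst \<circ> snd \<circ> obits) cs)"
  "snd (snd (obits (oparity w cs))) = parity w (map (snd \<circ> snd \<circ> obits) cs)"
  by (induction w cs rule: oparity.induct) (auto simp: obits_oxor)

lemma plane_subspace:
  "is_subspace (length cs) (plane cs :: 'a::{field,finite} vec set)"
  "sdim (length cs) (plane cs :: 'a vec set) \<le> 3"
proof -
  let ?S = "{bvec (map (fst \<circ> obits) cs), bvec (map (fst \<circ> snd \<circ> obits) cs),
    bvec (map (snd \<circ> snd \<circ> obits) cs)} :: 'a vec set"
  have S: "?S \<subseteq> carrier_vec (length cs)" by simp
  show "is_subspace (length cs) (plane cs :: 'a vec set)" using is_subspace_span[OF S] by (simp add: plane_def)
  have "sdim (length cs) (vspan (length cs) ?S) \<le> card ?S" using sdim_span_le[OF _ S] by simp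
  also have "card ?S \<le> 3" by (simp add: card_insert_if)
  finally show "sdim (length cs) (plane cs :: 'a vec set) \<le> 3" by (simp add: plane_def)
qed

lemma plane_subset_orth:
  assumes "CARD('f::{field,finite}) = 2" "length w = r" "length cs = r"
  shows "(plane cs :: 'f vec set) \<subseteq> orth r (bvec w) \<longleftrightarrow> oparity w cs = O0"
proof -
  let ?S = "{bvec (map (fst \<circ> obits) cs), bvec (map (fst \<circ> snd \<circ> obits) cs),
    bvec (map (snd \<circ> snd \<circ> obits) cs)} :: 'f vec set"
  have "vspan r ?S \<subseteq> orth r (bvec w) \<longleftrightarrow> ?S \<subseteq> orth r (bvec w)"
    using assms(2,3) by (intro span_subset_iff is_subspace_orth) auto
  also have "\<dots> \<longleftrightarrow> oparity w cs = O0"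
    using assms(2,3) by (simp add: orth_def scalar_prod_bvec[OF assms(1)] obits_eq_iff obits_oparity)
  finally show ?thesis using assms(3) by (simp add: plane_def)
qed

lemma contained_count_planes:
  assumes "CARD('f::{field,finite}) = 2" "length w = r" "\<And>cs. cs \<in> set ps \<Longrightarrow> length cs = r"
  shows "contained_count (mset (map plane ps)) (orth r (bvec w :: 'f vec)) =
    length (filter (\<lambda>cs. oparity w cs = O0) ps)"
  using assms(3) plane_subset_orth[OF assms(1,2)] by (induction ps) (auto simp: contained_count_def)

section \<open>Exhaustive check of all hyperplanes by a tree search\<close>

fun add_lists :: "oct list \<Rightarrow> oct list \<Rightarrow> oct list" where
  "add_lists (x # xs) (y # ys) = oxor x y # add_lists xs ys"
| "add_lists _ _ = []"

text \<open>The bound is counted down, so that evaluation stops at the first zero too many.\<close>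

fun few_zeros :: "nat \<Rightarrow> oct list \<Rightarrow> bool" where
  "few_zeros s [] = True"
| "few_zeros s (x # xs) =
    (case x of O0 \<Rightarrow> (case s of 0 \<Rightarrow> False | Suc s' \<Rightarrow> few_zeros s' xs) | _ \<Rightarrow> few_zeros s xs)"

text \<open>
  \<open>search s nz rs acc\<close> runs through the tree of all \<open>w \<in> F_2^r\<close>, one coordinate of all the planes (an element
  of \<open>rs\<close>) at a time; \<open>acc\<close> contains, for each plane, the products of its three generators with the part
  of \<open>w\<close> chosen so far, and \<open>nz\<close> says whether this part is nonzero.
\<close>

fun search :: "nat \<Rightarrow> bool \<Rightarrow> oct list list \<Rightarrow> oct list \<Rightarrow> bool" where
  "search s nz [] acc = (if nz then few_zeros s acc else True)"
| "search s nz (r # rs) acc = (if search s nz rs acc then search s True rs (add_lists acc r) else False)"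

fun coordinate_rows :: "nat \<Rightarrow> oct list list \<Rightarrow> oct list list" where
  "coordinate_rows 0 ps = []"
| "coordinate_rows (Suc r) ps = map hd ps # coordinate_rows r (map tl ps)"

text \<open>The accumulator with which \<open>search\<close> arrives at the leaf
  \<open>w\<close>.\<close>

fun parities :: "bool list \<Rightarrow> oct list list \<Rightarrow> oct list \<Rightarrow> oct list" where
  "parities (x # w) (r # rs) acc = parities w rs (if x then add_lists acc r else acc)"
| "parities _ _ acc = acc"

lemma few_zeros_iff: "few_zeros s xs \<longleftrightarrow> length (filter (\<lambda>x. x = O0) xs) \<le> s"
  by (induction s xs rule: few_zeros.induct) (auto split: nat.splits oct.splits)

text \<open>Each \<open>w\<close> is a path in the tree. The last assumption says that the flag is
  set at its leaf, where the zeros are counted; the zero vector, which is orthogonal to everything,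
  is exempt.\<close>

lemma search_sound:
  assumes "search s nz rs acc" "length w = length rs" "nz \<or> True \<in> set w"
  shows "few_zeros s (parities w rs acc)"
  using assms
proof (induction rs arbitrary: nz w acc)
  case Nil
  then show ?case by (auto split: if_splits)
next
  case (Cons r rs)
  obtain x v where w: "w = x # v" "length v = length rs" using Cons.prems(2) by (cases w) auto
  have "search s nz rs acc" "search s True rs (add_lists acc r)"
    using Cons.prems(1) by (auto split: if_splits)
  then show ?case using Cons.IH[of nz acc v] Cons.IH[of True "add_lists acc r" v] Cons.prems(3) w by (cases x) auto
qed

lemma length_coordinate_rows [simp]: "length (coordinate_rows r ps) = r"
  by (induction r arbitrary: ps) auto

text \<open>Generalised for the induction: \<open>h\<close> gives the columns of a plane that are
  still unread, \<open>g\<close> the digit accumulated so far.\<close>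

lemma parities_coordinate_rows:
  assumes "length w = r" "\<And>cs. cs \<in> set ps \<Longrightarrow> length (h cs) = r"
  shows "parities w (coordinate_rows r (map h ps)) (map g ps) = map (\<lambda>cs. oxor (g cs) (oparity w (h cs))) ps"
  using assms
proof (induction r arbitrary: w h g)
  case 0
  then show ?case by simp
next
  case (Suc r)
  obtain x v where w: "w = x # v" "length v = r" using Suc.prems(1) by (cases w) auto
  have h: "h cs = hd (h cs) # tl (h cs)" if "cs \<in> set ps" for cs
    using Suc.prems(2)[OF that] by (cases "h cs") auto
  let ?g = "\<lambda>cs. if x then oxor (g cs) (hd (h cs)) else g cs"
  have add: "add_lists (map g qs) (map (hd \<circ> h) qs) = map (\<lambda>cs. oxor (g cs) (hd (h cs))) qs" for qs
    by (induction qs) auto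
  have "parities w (coordinate_rows (Suc r) (map h ps)) (map g ps) = parities v (coordinate_rows r (map (tl \<circ> h) ps)) (map ?g ps)"
    by (simp add: w(1) add)
  also have "\<dots> = map (\<lambda>cs. oxor (?g cs) (oparity v ((tl \<circ> h) cs))) ps"
    using Suc.prems(2) by (intro Suc.IH w(2)) auto
  also have "\<dots> = map (\<lambda>cs. oxor (g cs) (oparity w (h cs))) ps"
  proof (rule map_cong[OF refl])
    fix cs assume "cs \<in> set ps"
    have "oparity w (h cs) = oxor (oparity v (tl (h cs))) (if x then hd (h cs) else O0)"
      unfolding w(1) by (subst h[OF \<open>cs \<in> set ps\<close>]) simp
    then show "oxor (?g cs) (oparity v ((tl \<circ> h) cs)) = oxor (g cs) (oparity w (h cs))"
      by (auto simp: oxor_assoc oxor_commute oxor_left_commute)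
  qed
  finally show ?case .
qed

lemma few_zeros_parities:
  assumes "length w = r" "\<And>cs. cs \<in> set ps \<Longrightarrow> length cs = r"
  shows "few_zeros s (parities w (coordinate_rows r ps) (map (\<lambda>_. O0) ps)) \<longleftrightarrow>
    length (filter (\<lambda>cs. oparity w cs = O0) ps) \<le> s"
  using parities_coordinate_rows[OF assms(1), of ps "\<lambda>cs. cs" "\<lambda>_. O0"] assms(2)
  by (simp add: few_zeros_iff filter_map o_def)

text \<open>The search bounds the count for every nonzero \<open>w\<close> by \<open>Suc s\<close>;
  as \<open>w0\<close> exceeds \<open>s\<close>, it attains this bound.\<close>

lemma planes_system:
  assumes f: "CARD('f::{field,finite}) = 2"
    and chk: "search (Suc s) False (coordinate_rows r ps) (map (\<lambda>_. O0) ps)"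
    and w0: "length w0 = r" "True \<in> set w0" "\<not> few_zeros s (parities w0 (coordinate_rows r ps) (map (\<lambda>_. O0) ps))"
    and n: "length ps = n" and r: "\<forall>cs\<in>set ps. length cs = r"
  shows "projective_system 3 n r (Suc s) (mset (map plane ps) :: 'f vec set multiset)"
proof (rule projective_systemI)
  have r': "length cs = r" if "cs \<in> set ps" for cs using r that by simp
  have nz: "bvec bs \<noteq> (0\<^sub>v r :: 'f vec) \<longleftrightarrow> True \<in> set bs" if "length bs = r" for bs
  proof -
    have "bvec bs = (0\<^sub>v r :: 'f vec) \<longleftrightarrow> (\<forall>i<r. \<not> bs ! i)"
      using that by (auto simp: bvec_def vec_eq_iff vec_of_list_index)
    then show ?thesis using that by (auto simp: in_set_conv_nth)
  qed
  have le: "length (filter (\<lambda>cs. oparity w cs = O0) ps) \<le> Suc s" if "length w = r" "True \<in> set w" for w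
    using search_sound[OF chk, of w] few_zeros_parities[OF that(1) r'] that by simp
  show "bvec w0 \<in> carrier_vec r" "bvec w0 \<noteq> (0\<^sub>v r :: 'f vec)" using w0 nz by auto
  show "contained_count (mset (map plane ps)) (orth r (bvec w0 :: 'f vec)) = Suc s"
    using contained_count_planes[OF f w0(1) r'] le[OF w0(1,2)] w0(3) few_zeros_parities[OF w0(1) r'] by simp
  fix w :: "'f vec" assume w: "w \<in> carrier_vec r" "w \<noteq> 0\<^sub>v r"
  obtain bs where bs: "length bs = r" "w = bvec bs" by (rule obtain_bvec[OF f w(1)])
  show "contained_count (mset (map plane ps)) (orth r w) \<le> Suc s"
    using le[OF bs(1)] nz[OF bs(1)] w(2) bs(2) contained_count_planes[OF f bs(1) r'] by metis
next
  show "is_subspace r U \<and> sdim r U \<le> 3" if U: "U \<in># mset (map plane ps)" for U :: "'f vec set"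
  proof -
    obtain cs where "cs \<in> set ps" "U = plane cs" using U by auto
    then show ?thesis using r plane_subspace[of cs] by metis
  qed
qed (use n in simp)

text \<open>
  Both systems were found by computer, prescribing a group of order 21. The first consists of orbits of the
  Frobenius group \<open>7:3\<close>, which acts on \<open>F_8^3\<close> by \<open>(x, y, z) \<mapsto> (a x, a y, a^3 z)\<close> for \<open>a \<noteq> 0\<close> and by the Frobenius
  automorphism.
\<close>

definition planes51 :: "oct list list" where
  "planes51 =
   [[O7, O1, O3, O2, O1, O2, O1, O2, O4], [O5, O7, O6, O3, O0, O6, O1, O2, O4],
    [O5, O7, O6, O6, O6, O7, O1, O2, O4], [O4, O5, O2, O4, O1, O0, O1, O2, O4],
    [O3, O4, O1, O7, O4, O4, O1, O2, O4], [O4, O5, O2, O2, O6, O4, O1, O2, O4],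
    [O3, O4, O1, O4, O5, O1, O1, O2, O4], [O3, O4, O1, O0, O7, O6, O1, O2, O4],
    [O2, O6, O5, O2, O0, O1, O1, O2, O4], [O6, O3, O7, O7, O5, O7, O1, O2, O4],
    [O7, O1, O3, O5, O2, O0, O1, O2, O4], [O2, O6, O5, O6, O2, O6, O1, O2, O4],
    [O6, O3, O7, O6, O1, O1, O1, O2, O4], [O6, O3, O7, O4, O4, O2, O1, O2, O4],
    [O7, O1, O3, O0, O4, O1, O1, O2, O4], [O1, O2, O4, O6, O5, O0, O1, O2, O4],
    [O4, O5, O2, O5, O5, O6, O1, O2, O4], [O5, O7, O6, O0, O1, O3, O1, O2, O4],
    [O1, O2, O4, O4, O0, O3, O1, O2, O4], [O2, O6, O5, O3, O4, O7, O1, O2, O4],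
    [O1, O2, O4, O2, O7, O7, O1, O2, O4], [O6, O7, O5, O7, O1, O2, O4, O0, O4],
    [O6, O3, O7, O1, O6, O2, O0, O0, O4], [O5, O7, O1, O6, O1, O2, O4, O4, O4],
    [O6, O7, O4, O1, O2, O4, O0, O4, O4], [O2, O4, O7, O1, O4, O2, O0, O4, O0],
    [O7, O3, O5, O5, O1, O2, O4, O4, O0], [O4, O2, O3, O4, O1, O2, O4, O0, O0],
    [O2, O5, O7, O7, O2, O1, O1, O2, O4], [O2, O1, O1, O6, O4, O3, O1, O2, O4],
    [O6, O5, O6, O5, O1, O7, O1, O2, O4], [O6, O1, O0, O4, O7, O5, O1, O2, O4],
    [O4, O0, O1, O2, O3, O6, O1, O2, O4], [O4, O4, O7, O3, O5, O4, O1, O2, O4],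
    [O0, O4, O6, O1, O6, O2, O1, O2, O4], [O0, O6, O0, O7, O1, O3, O1, O2, O4],
    [O0, O0, O4, O5, O7, O6, O1, O2, O4], [O7, O7, O0, O4, O5, O2, O1, O2, O4],
    [O0, O2, O2, O3, O4, O1, O1, O2, O4], [O5, O0, O5, O2, O6, O5, O1, O2, O4],
    [O3, O3, O3, O6, O3, O7, O1, O2, O4], [O1, O0, O0, O1, O2, O4, O1, O2, O4],
    [O3, O2, O2, O1, O3, O3, O1, O2, O4], [O3, O6, O3, O5, O3, O5, O1, O2, O4],
    [O7, O6, O0, O1, O7, O0, O1, O2, O4], [O5, O0, O4, O1, O0, O5, O1, O2, O4],
    [O7, O7, O3, O3, O3, O4, O1, O2, O4], [O0, O2, O4, O0, O6, O2, O1, O2, O4],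
    [O5, O7, O2, O7, O2, O5, O1, O2, O4], [O1, O2, O4, O1, O2, O4, O0, O0, O0],
    [O1, O2, O4, O0, O0, O0, O0, O0, O0]]"

text \<open>
  The second consists of orbits of a cyclic group of order 21 on \<open>F_64 \<times> F_8\<close>. Its planes cover the 21 points
  of one point orbit (the columns of a generator matrix of a \<open>[21, 9, 8]\<close> code) twice, and all other points
  once. A hyperplane \<open>H\<close> with \<open>i\<close> points of that orbit hence contains exactly \<open>(27 + i) / 4\<close> of the planes.
\<close>

definition planes76 :: "oct list list" where
  "planes76 =
   [[O2, O2, O0, O3, O1, O2, O4, O0, O4], [O1, O2, O1, O0, O2, O0, O0, O0, O4],
    [O0, O1, O1, O2, O1, O2, O4, O4, O4], [O1, O3, O3, O1, O2, O2, O0, O4, O0],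
    [O1, O2, O0, O2, O2, O2, O0, O4, O4], [O2, O0, O0, O1, O2, O0, O4, O0, O0],
    [O3, O1, O2, O2, O0, O0, O4, O4, O0], [O1, O4, O7, O1, O1, O0, O1, O2, O4],
    [O6, O0, O6, O6, O7, O2, O1, O2, O4], [O4, O6, O1, O7, O0, O4, O1, O2, O4],
    [O2, O2, O7, O0, O4, O6, O1, O2, O4], [O0, O7, O3, O7, O3, O2, O1, O2, O4],
    [O2, O7, O6, O3, O2, O5, O1, O2, O4], [O5, O6, O2, O2, O2, O4, O1, O2, O4],
    [O3, O0, O4, O6, O4, O3, O1, O2, O4], [O4, O3, O2, O0, O0, O7, O1, O2, O4],
    [O0, O0, O2, O5, O5, O3, O1, O2, O4], [O1, O0, O4, O5, O0, O3, O1, O2, O4],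
    [O1, O1, O5, O3, O0, O7, O1, O2, O4], [O5, O5, O2, O4, O6, O1, O1, O2, O4],
    [O7, O3, O2, O7, O1, O3, O1, O2, O4], [O2, O4, O3, O7, O5, O3, O1, O2, O4],
    [O2, O3, O4, O6, O7, O5, O1, O2, O4], [O4, O6, O3, O2, O5, O7, O1, O2, O4],
    [O3, O2, O3, O5, O4, O5, O1, O2, O4], [O1, O6, O6, O4, O3, O5, O1, O2, O4],
    [O7, O2, O4, O7, O4, O4, O1, O2, O4], [O2, O5, O0, O5, O3, O7, O1, O2, O4],
    [O4, O1, O4, O1, O2, O4, O0, O0, O0], [O2, O7, O1, O0, O2, O4, O0, O0, O0],
    [O0, O1, O6, O6, O2, O4, O0, O0, O0], [O7, O1, O0, O3, O1, O1, O1, O2, O4],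
    [O5, O3, O0, O4, O6, O0, O1, O2, O4], [O7, O3, O4, O1, O5, O0, O1, O2, O4],
    [O6, O7, O1, O2, O5, O7, O1, O2, O4], [O3, O2, O3, O6, O2, O6, O1, O2, O4],
    [O4, O7, O7, O1, O3, O5, O1, O2, O4], [O6, O3, O4, O6, O2, O2, O1, O2, O4],
    [O4, O7, O0, O7, O5, O7, O1, O2, O4], [O2, O3, O3, O5, O2, O0, O1, O2, O4],
    [O1, O2, O3, O3, O5, O5, O1, O2, O4], [O5, O4, O0, O7, O3, O5, O1, O2, O4],
    [O2, O7, O4, O0, O7, O0, O1, O2, O4], [O0, O2, O2, O3, O2, O7, O1, O2, O4],
    [O5, O6, O1, O2, O3, O3, O1, O2, O4], [O3, O6, O0, O4, O4, O6, O1, O2, O4],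
    [O7, O0, O3, O1, O4, O0, O1, O2, O4], [O6, O1, O7, O2, O0, O5, O1, O2, O4],
    [O3, O3, O1, O5, O6, O2, O1, O2, O4], [O1, O5, O7, O6, O5, O6, O1, O2, O4],
    [O4, O5, O5, O2, O1, O2, O1, O2, O4], [O3, O5, O5, O4, O1, O1, O1, O2, O4],
    [O1, O0, O2, O1, O2, O4, O0, O0, O0], [O7, O3, O1, O2, O0, O4, O0, O0, O0],
    [O6, O6, O1, O2, O2, O4, O0, O0, O0], [O0, O4, O1, O0, O3, O2, O1, O2, O4],
    [O0, O5, O6, O3, O7, O6, O1, O2, O4], [O5, O7, O6, O4, O1, O4, O1, O2, O4],
    [O7, O1, O1, O6, O2, O4, O1, O2, O4], [O4, O7, O4, O5, O6, O6, O1, O2, O4],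
    [O1, O5, O0, O3, O2, O7, O1, O2, O4], [O5, O6, O1, O4, O1, O0, O1, O2, O4],
    [O7, O1, O6, O1, O4, O6, O1, O2, O4], [O6, O1, O3, O6, O6, O4, O1, O2, O4],
    [O4, O0, O3, O3, O6, O5, O1, O2, O4], [O5, O1, O5, O6, O0, O5, O1, O2, O4],
    [O4, O4, O1, O0, O6, O1, O1, O2, O4], [O0, O4, O2, O1, O7, O6, O1, O2, O4],
    [O6, O4, O6, O4, O7, O3, O1, O2, O4], [O7, O5, O7, O1, O7, O4, O1, O2, O4],
    [O6, O4, O5, O5, O1, O2, O1, O2, O4], [O1, O7, O5, O7, O7, O1, O1, O2, O4],
    [O2, O0, O4, O0, O2, O1, O1, O2, O4], [O0, O3, O5, O5, O0, O7, O1, O2, O4],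
    [O1, O1, O2, O2, O5, O1, O1, O2, O4], [O3, O2, O7, O0, O6, O3, O1, O2, O4]]"

lemma system51:
  assumes "CARD('f::{field,finite}) = 2"
  shows "projective_system 3 51 9 7 (mset (map plane planes51) :: 'f vec set multiset)"
proof -
  \<comment> \<open>A hyperplane that contains more than 6 of the planes, hence exactly 7.\<close>
  let ?w = "[True, False, False, True, False, False, False, False, False]"
  have "search (Suc 6) False (coordinate_rows 9 planes51) (map (\<lambda>_. O0) planes51)" by code_simp
  moreover have "\<not> few_zeros 6 (parities ?w (coordinate_rows 9 planes51) (map (\<lambda>_. O0) planes51))" by code_simp
  moreover have "length planes51 = 51" "\<forall>cs\<in>set planes51. length cs = 9" by (simp_all add: planes51_def)
  ultimately show ?thesis using planes_system[OF assms, of 6 9 planes51 ?w 51] by simp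
qed

lemma system76:
  assumes "CARD('f::{field,finite}) = 2"
  shows "projective_system 3 76 9 10 (mset (map plane planes76) :: 'f vec set multiset)"
proof -
  \<comment> \<open>A hyperplane that contains more than 9 of the planes, hence exactly 10.\<close>
  let ?w = "[False, False, True, False, False, False, False, False, False]"
  have "search (Suc 9) False (coordinate_rows 9 planes76) (map (\<lambda>_. O0) planes76)" by code_simp
  moreover have "\<not> few_zeros 9 (parities ?w (coordinate_rows 9 planes76) (map (\<lambda>_. O0) planes76))" by code_simp
  moreover have "length planes76 = 76" "\<forall>cs\<in>set planes76. length cs = 9" by (simp_all add: planes76_def)
  ultimately show ?thesis using planes_system[OF assms, of 9 9 planes76 ?w 76] by simp
qed

section \<open>Polynomials with double zeros at all points of an affine plane of order 8\<close>

text \<open>\<open>Q k\<close> is the coefficient of \<open>x^k\<close> in the product of the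
  \<open>a x + b y + c\<close>, as a polynomial in \<open>y\<close>. Its top coefficient belongs to
  the homogeneous part of degree \<open>card I\<close>, which does not see the
  \<open>c i\<close>.\<close>

lemma coeff_prod_linear_top:
  fixes a b c :: "'i \<Rightarrow> 'a::field"
  assumes "finite I"
  obtains Q where "\<And>k. degree (Q k) \<le> card I - k"
    "\<And>k y. poly (Q k) y = coeff (\<Prod>i\<in>I. [:b i * y + c i, a i:]) k"
    "\<And>k. k \<le> card I \<Longrightarrow> coeff (Q k) (card I - k) = coeff (\<Prod>i\<in>I. [:b i, a i:]) k"
proof -
  \<comment> \<open>For \<open>k > card I\<close> the difference \<open>card I - k\<close> is
    truncated to 0, so the degree bound alone would admit constants; the induction carries
    \<open>Q k = 0\<close> along.\<close>
  have "\<exists>Q. \<forall>k. degree (Q k) \<le> card I - k \<and> (card I < k \<longrightarrow> Q k = 0) \<and>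
    (\<forall>y. poly (Q k) y = coeff (\<Prod>i\<in>I. [:b i * y + c i, a i:]) k) \<and>
    (k \<le> card I \<longrightarrow> coeff (Q k) (card I - k) = coeff (\<Prod>i\<in>I. [:b i, a i:]) k)"
    using assms
  proof (induction I)
    case empty
    show ?case by (rule exI[of _ "\<lambda>k. if k = 0 then 1 else 0"]) (auto simp: one_pCons coeff_pCons split: nat.splits)
  next
    case (insert j I)
    obtain Q where Q: "\<And>k. degree (Q k) \<le> card I - k" "\<And>k. card I < k \<Longrightarrow> Q k = 0"
      "\<And>k y. poly (Q k) y = coeff (\<Prod>i\<in>I. [:b i * y + c i, a i:]) k"
      "\<And>k. k \<le> card I \<Longrightarrow> coeff (Q k) (card I - k) = coeff (\<Prod>i\<in>I. [:b i, a i:]) k"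
    proof -
      from insert.IH obtain Q where "\<forall>k. degree (Q k) \<le> card I - k \<and> (card I < k \<longrightarrow> Q k = 0) \<and>
        (\<forall>y. poly (Q k) y = coeff (\<Prod>i\<in>I. [:b i * y + c i, a i:]) k) \<and>
        (k \<le> card I \<longrightarrow> coeff (Q k) (card I - k) = coeff (\<Prod>i\<in>I. [:b i, a i:]) k)" ..
      then show ?thesis by (intro that[of Q]) simp_all
    qed
    \<comment> \<open>Multiplication by the new factor, read as \<open>a j * x\<close> plus the
      polynomial \<open>[:c j, b j:]\<close> in \<open>y\<close>.\<close>
    define R where "R k = [:c j, b j:] * Q k + (if k = 0 then 0 else Polynomial.smult (a j) (Q (k - 1)))" for k
    have coeff_mult: "coeff ([:p, q:] * f) k = p * coeff f k + (if k = 0 then 0 else q * coeff f (k - 1))"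
      for p q :: 'a and f k
      by (cases k) (simp_all add: coeff_pCons)
    have n: "card (insert j I) = Suc (card I)" using insert by simp
    have "degree (R k) \<le> card (insert j I) - k \<and> (card (insert j I) < k \<longrightarrow> R k = 0) \<and>
      (\<forall>y. poly (R k) y = coeff (\<Prod>i\<in>insert j I. [:b i * y + c i, a i:]) k) \<and>
      (k \<le> card (insert j I) \<longrightarrow> coeff (R k) (card (insert j I) - k) = coeff (\<Prod>i\<in>insert j I. [:b i, a i:]) k)" for k
    proof (intro conjI allI impI)
      show "R k = 0" if "card (insert j I) < k" using that n Q(2)[of k] Q(2)[of "k - 1"] by (simp add: R_def)
      show "degree (R k) \<le> card (insert j I) - k"
      proof (cases "k \<le> card I")
        case True
        have "degree ([:c j, b j:] * Q k) \<le> 1 + (card I - k)"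
          by (rule order.trans[OF degree_mult_le]) (use Q(1)[of k] in \<open>auto intro!: add_mono\<close>)
        moreover have "degree (if k = 0 then 0 else Polynomial.smult (a j) (Q (k - 1))) \<le> 1 + (card I - k)"
          using Q(1)[of "k - 1"] degree_smult_le[of "a j" "Q (k - 1)"] True by auto
        ultimately show ?thesis unfolding R_def n using True by (intro degree_add_le) auto
      next
        case False
        then have "Q k = 0" using Q(2) by simp
        then show ?thesis using Q(1)[of "k - 1"] degree_smult_le[of "a j" "Q (k - 1)"] False by (auto simp: R_def n)
      qed
      show "poly (R k) y = coeff (\<Prod>i\<in>insert j I. [:b i * y + c i, a i:]) k" for y
        using insert by (simp add: R_def coeff_mult Q(3) algebra_simps del: mult_pCons_left)
      show "coeff (R k) (card (insert j I) - k) = coeff (\<Prod>i\<in>insert j I. [:b i, a i:]) k"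
        if k: "k \<le> card (insert j I)"
      proof -
        have 1: "coeff ([:c j, b j:] * Q k) (Suc (card I) - k) = b j * coeff (\<Prod>i\<in>I. [:b i, a i:]) k"
        proof (cases "k \<le> card I")
          case True
          have "coeff (Q k) (Suc (card I - k)) = 0" using Q(1)[of k] by (intro coeff_eq_0) simp
          then show ?thesis using True Q(4)[of k] by (simp add: coeff_mult Suc_diff_le del: mult_pCons_left)
        next
          case False
          have "degree (\<Prod>i\<in>I. [:b i, a i:]) \<le> (\<Sum>i\<in>I. degree [:b i, a i:])"
            using degree_prod_sum_le[OF insert(1), of "\<lambda>i. [:b i, a i:]"] by (simp only: o_def)
          also have "\<dots> \<le> (\<Sum>i\<in>I. 1)" by (intro sum_mono) simp
          finally have "coeff (\<Prod>i\<in>I. [:b i, a i:]) k = 0" using False by (intro coeff_eq_0) simp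
          then show ?thesis using False Q(2)[of k] by simp
        qed
        show ?thesis
        proof (cases k)
          case 0
          then show ?thesis using 1 insert n by (simp add: R_def coeff_mult del: mult_pCons_left)
        next
          case (Suc k')
          then have "coeff (Q k') (card I - k') = coeff (\<Prod>i\<in>I. [:b i, a i:]) k'" using k n by (intro Q(4)) simp
          then show ?thesis using 1 insert n Suc by (simp add: R_def coeff_mult del: mult_pCons_left)
        qed
      qed
    qed
    then show ?case by blast
  qed
  then obtain Q where "\<forall>k. degree (Q k) \<le> card I - k \<and> (card I < k \<longrightarrow> Q k = 0) \<and>
    (\<forall>y. poly (Q k) y = coeff (\<Prod>i\<in>I. [:b i * y + c i, a i:]) k) \<and>
    (k \<le> card I \<longrightarrow> coeff (Q k) (card I - k) = coeff (\<Prod>i\<in>I. [:b i, a i:]) k)" ..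
  then show ?thesis by (intro that[of Q]) simp_all
qed

text \<open>Exchanging the two coefficients of every factor turns the product \<open>p\<close> into
  \<open>X^n p(1/X)\<close>, where \<open>n = card I\<close>.\<close>

lemma coeff_prod_linear_reflect:
  fixes a b :: "'i \<Rightarrow> 'a::field"
  assumes "finite I" "k \<le> card I"
  shows "coeff (\<Prod>i\<in>I. [:b i, a i:]) k = coeff (\<Prod>i\<in>I. [:a i, b i:]) (card I - k)"
  using assms
proof (induction I arbitrary: k)
  case empty
  then show ?case by simp
next
  case (insert j I)
  have coeff_mult: "coeff ([:p, q:] * f) k = p * coeff f k + (if k = 0 then 0 else q * coeff f (k - 1))"
    for p q :: 'a and f k
    by (cases k) (simp_all add: coeff_pCons)
  have z: "coeff (\<Prod>i\<in>I. [:b i, a i:]) m = 0" if "m > card I" for m and a b :: "'i \<Rightarrow> 'a"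
  proof (rule coeff_eq_0)
    have "degree (\<Prod>i\<in>I. [:b i, a i:]) \<le> (\<Sum>i\<in>I. degree [:b i, a i:])"
      using degree_prod_sum_le[OF insert(1), of "\<lambda>i. [:b i, a i:]"] by (simp only: o_def)
    also have "\<dots> \<le> (\<Sum>i\<in>I. 1)" by (intro sum_mono) simp
    finally show "degree (\<Prod>i\<in>I. [:b i, a i:]) < m" using that by simp
  qed
  have n: "card (insert j I) = Suc (card I)" using insert by simp
  consider "k = 0" | "k = Suc (card I)" | "0 < k" "k \<le> card I" using insert.prems n by linarith
  then show ?case
  proof cases
    case 1
    then show ?thesis using insert insert.IH[of 0] n z by (simp add: coeff_mult del: mult_pCons_left)
  next
    case 2
    then show ?thesis using insert insert.IH[of "card I"] n z by (simp add: coeff_mult del: mult_pCons_left)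
  next
    case 3
    then have "Suc (card I) - k = Suc (card I - k)" "card I - (k - 1) = Suc (card I - k)" by auto
    then show ?thesis using insert insert.IH[of k] insert.IH[of "k - 1"] n 3 by (simp add: coeff_mult del: mult_pCons_left)
  qed
qed

section \<open>Polynomials over the field with eight elements\<close>

lemma field8_pow:
  assumes "CARD('k::{field,finite}) = 8"
  shows "(2::'k) = 0" "x ^ 8 = (x::'k)"
proof -
  \<comment> \<open>Translation by 1 permutes the field, so the sum of eight ones is 0; in the same
    way, multiplication by \<open>x\<close> permutes the nonzero elements below.\<close>
  have "(\<Sum>y\<in>UNIV. y + 1) = (\<Sum>y\<in>UNIV. y :: 'k)"
    by (rule sum.reindex_bij_witness[of _ "\<lambda>y. y - 1" "\<lambda>y. y + 1"]) auto
  then have "of_nat CARD('k) = (0::'k)" by (simp add: sum.distrib)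
  then have "(8::'k) = 0" using assms by simp
  moreover have "(2::'k) ^ 3 = 8" by simp
  ultimately have "(2::'k) ^ 3 = 0" by metis
  then show "(2::'k) = 0" unfolding power_eq_0_iff by simp
  show "x ^ 8 = x"
  proof (cases "x = 0")
    case False
    let ?U = "UNIV - {0::'k}"
    have "(\<Prod>y\<in>?U. x * y) = (\<Prod>y\<in>?U. y)"
      by (rule prod.reindex_bij_witness[of _ "\<lambda>y. y / x" "\<lambda>y. x * y"]) (use False in auto)
    moreover have "(\<Prod>y\<in>?U. y) \<noteq> 0" by simp
    ultimately have "x ^ card ?U = 1" by (simp add: prod.distrib)
    then have "x ^ 7 = 1" using assms by (simp add: card_Diff_singleton)
    then show ?thesis using power_Suc[of x 7] by simp
  qed simp
qed

lemma poly_all_roots_eq_0: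
  fixes p :: "'k::{field,finite} poly"
  assumes "degree p < CARD('k)" "\<And>x. poly p x = 0"
  shows "p = 0"
proof (rule ccontr)
  assume "p \<noteq> 0"
  then have "card {x. poly p x = 0} \<le> degree p" by (rule card_poly_roots_bound)
  then show False using assms by simp
qed

text \<open>The three coefficients are those whose exponents are positive multiples of \<open>q - 1 = 7\<close>: their
  sum is, up to sign, the sum of all values of \<open>p\<close>.\<close>

lemma coeff_sum_eq_0:
  fixes p :: "'k::{field,finite} poly"
  assumes k: "CARD('k) = 8" and "degree p \<le> 21" "\<And>x. poly p x = 0"
  shows "coeff p 7 + coeff p 14 + coeff p 21 = 0"
proof -
  \<comment> \<open>\<open>X^8 - X\<close> vanishes everywhere and so divides \<open>p\<close>. The
    cofactor \<open>f\<close> has degree at most 13, and the three coefficients telescope: they are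
    \<open>- f_6\<close>, \<open>f_6 - f_13\<close> and \<open>f_13 - f_20\<close>, with
    \<open>f_20 = 0\<close>.\<close>
  define q :: "'k poly" where "q = monom 1 8 - monom 1 1"
  have q0: "poly q x = 0" for x using field8_pow(2)[OF k] by (simp add: q_def poly_monom)
  have "coeff q 8 = 1" by (simp add: q_def)
  then have qn: "q \<noteq> 0" "8 \<le> degree q" using le_degree[of q 8] by auto
  have "degree q \<le> 8" unfolding q_def by (intro degree_diff_le) (simp_all add: degree_monom_eq)
  with qn have dq: "degree q = 8" by simp
  have "p mod q = 0"
  proof (rule poly_all_roots_eq_0)
    show "degree (p mod q) < CARD('k)" using degree_mod_less[OF qn(1), of p] dq k by auto
    show "poly (p mod q) x = 0" for x
    proof -
      have "poly p x = poly (p div q) x * poly q x + poly (p mod q) x"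
        by (metis poly_add poly_mult div_mult_mod_eq)
      then show ?thesis using assms(3) q0 by simp
    qed
  qed
  then obtain f where f: "p = q * f" by (auto elim: dvdE)
  have df: "coeff f n = 0" if "n \<ge> 14" for n
  proof (cases "f = 0")
    case False
    then have "degree p = 8 + degree f" using f qn(1) dq by (simp add: degree_mult_eq)
    then show ?thesis using assms(2) that by (intro coeff_eq_0) simp
  qed simp
  have "coeff p n = (if n < 8 then 0 else coeff f (n - 8)) - (if n < 1 then 0 else coeff f (n - 1))" for n
    unfolding f q_def by (simp add: left_diff_distrib coeff_monom_mult)
  then show ?thesis using df[of 20] by simp
qed

lemma poly_pderiv_double_root:
  fixes f :: "'i \<Rightarrow> 'a::field poly"
  assumes "finite I" "i \<in> I" "j \<in> I" "i \<noteq> j" "poly (f i) x = 0" "poly (f j) x = 0"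
  shows "poly (pderiv (\<Prod>l\<in>I. f l)) x = 0"
proof -
  have "(\<Prod>l\<in>I. f l) = f i * (f j * (\<Prod>l\<in>I - {i} - {j}. f l))"
    using assms(1-4) by (simp add: prod.remove[of I i] prod.remove[of "I - {i}" j])
  then show ?thesis using assms(5,6) by (simp add: pderiv_mult)
qed

lemma degree_prod_linear_le:
  fixes a b :: "'i \<Rightarrow> 'a::field"
  assumes "finite I"
  shows "degree (\<Prod>i\<in>I. [:b i, a i:]) \<le> card I"
proof -
  have "degree (\<Prod>i\<in>I. [:b i, a i:]) \<le> (\<Sum>i\<in>I. degree [:b i, a i:])"
    using degree_prod_sum_le[OF assms, of "\<lambda>i. [:b i, a i:]"] by (simp only: o_def)
  also have "\<dots> \<le> (\<Sum>i\<in>I. 1)" by (intro sum_mono) simp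
  finally show ?thesis by simp
qed

text \<open>For fixed \<open>y\<close>, the derivative in \<open>x\<close> vanishes on the whole
  field. Its coefficients at 7, 14 and 21 are 8, 15 and 22 times coefficients of the product, and in
  characteristic 2 only the middle one survives. So \<open>Q 15\<close>, of degree at most 7, has
  eight roots.\<close>

lemma double_cover_coeff:
  fixes a b c :: "'i \<Rightarrow> 'k::{field,finite}"
  assumes k: "CARD('k) = 8" and I: "finite I" "card I = 22"
    and cover: "\<And>x y. \<exists>i\<in>I. \<exists>j\<in>I. i \<noteq> j \<and> a i * x + b i * y + c i = 0 \<and> a j * x + b j * y + c j = 0"
  shows "coeff (\<Prod>i\<in>I. [:b i, a i:]) 15 = 0"
proof -
  obtain Q where Q: "\<And>k. degree (Q k) \<le> card I - k"
    "\<And>k y. poly (Q k) y = coeff (\<Prod>i\<in>I. [:b i * y + c i, a i:]) k"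
    "\<And>k. k \<le> card I \<Longrightarrow> coeff (Q k) (card I - k) = coeff (\<Prod>i\<in>I. [:b i, a i:]) k"
    using coeff_prod_linear_top[OF I(1), of b c a] by blast
  have "poly (Q 15) y = 0" for y
  proof -
    let ?p = "\<Prod>i\<in>I. [:b i * y + c i, a i:]"
    have "poly (pderiv ?p) x = 0" for x
    proof -
      obtain i j where "i \<in> I" "j \<in> I" "i \<noteq> j" "a i * x + b i * y + c i = 0" "a j * x + b j * y + c j = 0"
        using cover by blast
      then show ?thesis by (intro poly_pderiv_double_root[OF I(1), of i j]) (auto simp: algebra_simps)
    qed
    moreover have "degree (pderiv ?p) \<le> 21"
    proof (rule degree_le, intro allI impI)
      fix n :: nat assume "21 < n"
      then have "coeff ?p (Suc n) = 0"
        using degree_prod_linear_le[OF I(1), of "\<lambda>i. b i * y + c i" a] I(2) by (intro coeff_eq_0) simp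
      then show "coeff (pderiv ?p) n = 0" by (simp add: coeff_pderiv)
    qed
    ultimately have "coeff (pderiv ?p) 7 + coeff (pderiv ?p) 14 + coeff (pderiv ?p) 21 = 0"
      by (intro coeff_sum_eq_0[OF k])
    moreover have "of_nat 8 = (0::'k)" "of_nat 15 = (1::'k)" "of_nat 22 = (0::'k)"
    proof -
      have e: "of_nat (2 * n) = (0::'k)" for n using field8_pow(1)[OF k] by simp
      show "of_nat 8 = (0::'k)" "of_nat 22 = (0::'k)" using e[of 4] e[of 11] by simp_all
      have "of_nat (2 * 7 + 1) = (1::'k)" unfolding of_nat_add e by simp
      then show "of_nat 15 = (1::'k)" by simp
    qed
    ultimately have "coeff ?p 15 = 0" by (simp add: coeff_pderiv del: of_nat_numeral)
    then show ?thesis using Q(2) by simp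
  qed
  then have "Q 15 = 0" using Q(1)[of 15] I(2) k by (intro poly_all_roots_eq_0) auto
  then show ?thesis using Q(3)[of 15] I(2) by simp
qed

text \<open>The reflection of the factorisation of \<open>X^8 - X\<close> into the factors
  \<open>X - t\<close>, with signs dropped in characteristic 2.\<close>

lemma prod_linear_field8:
  assumes k: "CARD('k::{field,finite}) = 8"
  shows "(\<Prod>t\<in>UNIV. [:1, t::'k:]) = 1 + monom 1 7"
proof -
  have m: "- t = (t::'k)" for t
    using field8_pow(1)[OF k] by (metis add_eq_0_iff mult_2 mult_zero_left)
  let ?p = "\<Prod>t\<in>UNIV. [:t, 1::'k:]" and ?q = "monom 1 8 - monom 1 1 :: 'k poly"
  have "?p - ?q = 0"
  proof (rule poly_all_roots_eq_0)
    have le: "degree (?p - ?q) \<le> 8"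
      using degree_prod_linear_le[of UNIV "\<lambda>t. t" "\<lambda>_. 1::'k"] k
      by (intro degree_diff_le) (simp_all add: degree_monom_eq)
    have "lead_coeff ?p = 1" by (simp add: lead_coeff_prod)
    moreover have "degree ?p = 8" using k by (simp add: degree_prod_eq_sum_degree)
    ultimately have "coeff (?p - ?q) 8 = 0" by simp
    then show "degree (?p - ?q) < CARD('k)" using le k by (metis leading_coeff_0_iff le_neq_implies_less degree_0 zero_less_numeral)
    show "poly (?p - ?q) x = 0" for x
    proof -
      have "x + x = 0" using m[of x] by (metis add.right_inverse)
      then have "poly ?p x = 0" unfolding poly_prod by (intro prod_zero bexI[of _ x]) simp_all
      then show ?thesis using field8_pow(2)[OF k, of x] by (simp add: poly_monom)
    qed
  qed
  then have pq: "?p = ?q" by simp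
  show ?thesis
  proof (rule poly_eqI)
    fix n
    show "coeff (\<Prod>t\<in>UNIV. [:1, t::'k:]) n = coeff (1 + monom 1 7) n"
    proof (cases "n \<le> 8")
      case True
      have "coeff (\<Prod>t\<in>UNIV. [:1, t::'k:]) n = coeff ?p (8 - n)"
        using coeff_prod_linear_reflect[of UNIV n "\<lambda>_. 1" "\<lambda>t::'k. t"] True k by simp
      also have "\<dots> = coeff (1 + monom 1 7) n"
        unfolding pq using True m[of 1] by (auto simp: one_pCons coeff_pCons split: nat.splits)
      finally show ?thesis .
    next
      case False
      then have "coeff (\<Prod>t\<in>UNIV. [:1, t::'k:]) n = 0"
        using degree_prod_linear_le[of UNIV "\<lambda>_. 1" "\<lambda>t::'k. t"] k by (intro coeff_eq_0) simp
      then show ?thesis using False by (auto simp: one_pCons coeff_pCons split: nat.splits)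
    qed
  qed
qed

text \<open>Here \<open>a i = 0\<close> singles out the points on \<open>l\<close>, and
  \<open>b i = t * a i\<close> those on \<open>l_t\<close>. Since \<open>P\<close> is left out, a
  line of excess \<open>e\<close> has \<open>e + 1\<close> points in \<open>I\<close>. One factor
  per line \<open>l_t\<close> gives \<open>1 + X^7\<close>, so the product of the
  \<open>a i + b i X\<close> is a nonzero constant times \<open>X^(d+1) (1 + X^7) A\<close>, where
  \<open>A\<close> is the product of the \<open>(1 + t X)^(e t)\<close>. Its coefficients at 7 and
  15 vanish.\<close>

lemma double_cover_local:
  fixes a b c :: "'i \<Rightarrow> 'k::{field,finite}" and e :: "'k \<Rightarrow> nat"
  assumes k: "CARD('k) = 8" and I: "finite I" "card I = 22"
    and cover: "\<And>x y. \<exists>i\<in>I. \<exists>j\<in>I. i \<noteq> j \<and> a i * x + b i * y + c i = 0 \<and> a j * x + b j * y + c j = 0"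
    and nz: "\<And>i. i \<in> I \<Longrightarrow> a i = 0 \<Longrightarrow> b i \<noteq> 0"
    and d: "card {i \<in> I. a i = 0} = d + 1" "d \<le> 7"
    and e: "\<And>t. card {i \<in> I. a i \<noteq> 0 \<and> b i = t * a i} = e t + 1"
  shows "d \<le> 5" "sum e UNIV = 13 - d"
    "coeff (\<Prod>t\<in>UNIV. [:1, t:] ^ e t) (6 - d) = 0" "coeff (\<Prod>t\<in>UNIV. [:1, t:] ^ e t) (7 - d) = 0"
proof -
  let ?A = "\<Prod>t\<in>UNIV. [:1, t:] ^ e t"
  let ?Z = "{i \<in> I. a i = 0}" and ?N = "{i \<in> I. a i \<noteq> 0}"
  have IZ: "I = ?Z \<union> ?N" "?Z \<inter> ?N = {}" by auto
  have N: "?N = (\<Union>t. {i \<in> I. a i \<noteq> 0 \<and> b i = t * a i})" (is "_ = (\<Union>t. ?F t)")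
  proof -
    have "i \<in> ?F (b i / a i)" if "i \<in> ?N" for i using that by simp
    then show ?thesis by blast
  qed
  have disj: "?F s \<inter> ?F t = {}" if "s \<noteq> t" for s t using that by auto
  have "22 = card ?Z + card ?N" using card_Un_disjoint[of ?Z ?N] IZ I by auto
  also have "card ?N = (\<Sum>t\<in>UNIV. card (?F t))"
    unfolding N using I(1) disj by (intro card_UN_disjoint) auto
  also have "\<dots> = sum e UNIV + 8" using e k by (simp add: sum_Suc)
  finally show se: "sum e UNIV = 13 - d" using d by simp
  have "(\<Prod>i\<in>?Z. [:a i, b i:]) = (\<Prod>i\<in>?Z. Polynomial.smult (b i) (monom 1 1))"
    by (intro prod.cong refl) (simp add: monom_altdef)
  also have "\<dots> = Polynomial.smult (\<Prod>i\<in>?Z. b i) (monom 1 (d + 1))"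
    by (simp only: prod_smult prod_constant d(1) monom_altdef Polynomial.smult_1_left power_one_right)
  finally have 1: "(\<Prod>i\<in>?Z. [:a i, b i:]) = Polynomial.smult (\<Prod>i\<in>?Z. b i) (monom 1 (d + 1))" .
  have "(\<Prod>i\<in>?N. [:a i, b i:]) = (\<Prod>t\<in>UNIV. \<Prod>i\<in>?F t. [:a i, b i:])"
    unfolding N using I(1) disj by (intro prod.UNION_disjoint) auto
  also have "\<dots> = (\<Prod>t\<in>UNIV. \<Prod>i\<in>?F t. Polynomial.smult (a i) [:1, t:])"
    by (intro prod.cong refl) (auto simp: mult.commute)
  also have "\<dots> = Polynomial.smult (\<Prod>t\<in>UNIV. \<Prod>i\<in>?F t. a i) (\<Prod>t\<in>UNIV. [:1, t:] ^ (e t + 1))"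
    by (simp only: prod_smult prod_constant e)
  also have "(\<Prod>t\<in>UNIV. [:1, t:] ^ (e t + 1)) = (1 + monom 1 7) * ?A"
    unfolding power_add prod.distrib power_one_right prod_linear_field8[OF k] by (rule mult.commute)
  finally have 2: "(\<Prod>i\<in>?N. [:a i, b i:]) =
    Polynomial.smult (\<Prod>t\<in>UNIV. \<Prod>i\<in>?F t. a i) ((1 + monom 1 7) * ?A)" .
  define C where "C = (\<Prod>i\<in>?Z. b i) * (\<Prod>t\<in>UNIV. \<Prod>i\<in>?F t. a i)"
  have C: "C \<noteq> 0" unfolding C_def using nz I(1) by auto
  have "(\<Prod>i\<in>I. [:a i, b i:]) = (\<Prod>i\<in>?Z. [:a i, b i:]) * (\<Prod>i\<in>?N. [:a i, b i:])"
    using prod.union_disjoint[of ?Z ?N "\<lambda>i. [:a i, b i:]"] IZ(2) I(1) unfolding IZ(1)[symmetric] by simp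
  then have D: "(\<Prod>i\<in>I. [:a i, b i:]) = Polynomial.smult C (monom 1 (d + 1) * ((1 + monom 1 7) * ?A))"
    unfolding 1 2 by (simp add: C_def ac_simps)
  have "coeff (\<Prod>i\<in>I. [:b i, a i:]) 15 = 0" by (rule double_cover_coeff[OF k I cover])
  then have c7: "coeff (\<Prod>i\<in>I. [:a i, b i:]) 7 = 0"
    using coeff_prod_linear_reflect[OF I(1), of 7 a b] I(2) by simp
  \<comment> \<open>The hypothesis is symmetric under exchanging \<open>x\<close> and
    \<open>y\<close>, which exchanges \<open>a\<close> and \<open>b\<close>.\<close>
  have "\<exists>i\<in>I. \<exists>j\<in>I. i \<noteq> j \<and> b i * x + a i * y + c i = 0 \<and> b j * x + a j * y + c j = 0" for x y
    using cover[of y x] by (simp add: add.commute add.left_commute add.assoc)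
  then have c15: "coeff (\<Prod>i\<in>I. [:a i, b i:]) 15 = 0" by (intro double_cover_coeff[OF k I])
  have cf: "coeff (\<Prod>i\<in>I. [:a i, b i:]) n =
    C * (if n < d + 1 then 0 else coeff ?A (n - (d + 1)) + (if n - (d + 1) < 7 then 0 else coeff ?A (n - (d + 1) - 7)))" for n
    unfolding D by (simp add: coeff_monom_mult distrib_right)
  have "degree ?A \<le> (\<Sum>t\<in>UNIV. degree ([:1, t:] ^ e t))"
    using degree_prod_sum_le[of UNIV "\<lambda>t. [:1, t:] ^ e t"] by (simp only: o_def finite)
  also have "\<dots> \<le> (\<Sum>t\<in>UNIV. e t)"
    by (intro sum_mono) (metis (no_types, lifting) degree_pCons_le degree_power_le degree_pCons_0 le_trans mult_le_mono1 mult_1 One_nat_def)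
  finally have dA: "degree ?A \<le> 13 - d" using se by simp
  have A0: "coeff ?A 0 = 1" by (simp add: poly_0_coeff_0[symmetric] poly_prod)
  \<comment> \<open>Coefficient 15 is, up to \<open>C\<close>, the sum of those of \<open>A\<close>
    at \<open>14 - d\<close> and \<open>7 - d\<close>, and the former exceeds the degree. The values
    \<open>d = 7\<close> and then \<open>d = 6\<close> fall away because they would annihilate the
    constant coefficient 1 of \<open>A\<close>.\<close>
  have "coeff ?A (14 - d) = 0" using dA d(2) by (intro coeff_eq_0) simp
  moreover have "\<not> 15 < d + 1" "\<not> 15 - (d + 1) < 7" "15 - (d + 1) = 14 - d" "14 - d - 7 = 7 - d"
    using d(2) by auto
  ultimately have 7: "coeff ?A (7 - d) = 0" using c15 C cf[of 15] by auto
  then have "d \<noteq> 7" using A0 by auto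
  then have 6: "coeff ?A (6 - d) = 0" using c7 C d(2) cf[of 7] by (auto split: if_splits)
  then have "d \<noteq> 6" using A0 by auto
  with \<open>d \<noteq> 7\<close> show "d \<le> 5" using d(2) by simp
  show "coeff ?A (6 - d) = 0" "coeff ?A (7 - d) = 0" by fact+
qed

section \<open>Multisets of roots in the field with eight elements\<close>

primrec odiv :: "oct \<Rightarrow> oct" where
  "odiv O0 = O0"
| "odiv O1 = O5"
| "odiv O2 = O1"
| "odiv O3 = O4"
| "odiv O4 = O2"
| "odiv O5 = O7"
| "odiv O6 = O3"
| "odiv O7 = O6"

text \<open>
  The digits now stand for the elements of \<open>F_8 = F_2[z] / (z^3 + z + 1)\<close>, and \<open>odiv\<close> is division by \<open>z\<close>. For a
  product of linear factors \<open>1 + s X\<close>, the coefficients of \<open>X\<close>, \<open>X\<^sup>2\<close> and \<open>X\<^sup>3\<close> are recorded after division by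
  \<open>t\<close>, \<open>t\<^sup>2\<close> and \<open>t\<^sup>3\<close>, where \<open>t\<close> is the current root. Multiplication by \<open>1 + t X\<close> then becomes the map
  \<open>step\<close>, and passing from \<open>t\<close> to \<open>t z\<close> becomes \<open>rescale\<close>: no multiplication table is needed.
\<close>

type_synonym coeffs = "oct \<times> oct \<times> oct"

fun step :: "coeffs \<Rightarrow> coeffs" where
  "step (x, y, z) = (oxor x O1, oxor y x, oxor z y)"

fun rescale :: "coeffs \<Rightarrow> coeffs" where
  "rescale (x, y, z) = (odiv x, odiv (odiv y), odiv (odiv (odiv z)))"

primrec run :: "coeffs \<Rightarrow> nat list \<Rightarrow> coeffs" where
  "run u [] = u"
| "run u (m # ms) = run ((step ^^ m) (rescale u)) ms"

text \<open>
  \<open>multisets ok cap j left c m u es\<close> tests all ways to distribute \<open>left\<close> further factors among the current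
  root (which has received \<open>m\<close> factors and may receive \<open>c\<close> more) and \<open>j\<close> further roots (at most \<open>cap\<close> each);
  \<open>es\<close> lists the multiplicities of the finished roots.
\<close>

function (sequential) multisets ::
    "(coeffs \<Rightarrow> nat list \<Rightarrow> bool) \<Rightarrow> nat \<Rightarrow> nat \<Rightarrow> nat \<Rightarrow> nat \<Rightarrow> nat \<Rightarrow> coeffs \<Rightarrow> nat list \<Rightarrow> bool" where
  "multisets ok cap j left c m u es =
    (if (case j of 0 \<Rightarrow> (case left of 0 \<Rightarrow> ok u (m # es) | Suc l \<Rightarrow> True)
         | Suc i \<Rightarrow> multisets ok cap i left cap 0 (rescale u) (m # es))
     then (case left of 0 \<Rightarrow> True | Suc l \<Rightarrow> (case c of 0 \<Rightarrow> True
         | Suc d \<Rightarrow> multisets ok cap j l d (Suc m) (step u) es))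
     else False)"
  by pat_completeness auto
termination
  by (relation "measures [\<lambda>(ok, cap, j, left, c, m, u, es). j, \<lambda>(ok, cap, j, left, c, m, u, es). left]") auto

declare multisets.simps [simp del]

text \<open>The current root receives \<open>k\<close> more factors and the later roots the numbers
  in \<open>ms\<close>. At \<open>k = 0\<close> the enumeration passes to the next root, otherwise
  it takes one factor more.\<close>

lemma multisets_sound:
  assumes "multisets ok cap j left c m u es" "length ms = j" "\<forall>x\<in>set ms. x \<le> cap" "k \<le> c"
    "k + sum_list ms = left"
  shows "ok (run ((step ^^ k) u) ms) (rev ms @ (m + k) # es)"
  using assms
proof (induction ok cap j left c m u es arbitrary: k ms rule: multisets.induct)
  case (1 ok cap j left c m u es)
  note prems = "1.prems"
  have now: "case j of 0 \<Rightarrow> (case left of 0 \<Rightarrow> ok u (m # es) | Suc l \<Rightarrow> True)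
         | Suc i \<Rightarrow> multisets ok cap i left cap 0 (rescale u) (m # es)"
    and later: "case left of 0 \<Rightarrow> True | Suc l \<Rightarrow> (case c of 0 \<Rightarrow> True
         | Suc d \<Rightarrow> multisets ok cap j l d (Suc m) (step u) es)"
    using prems(1) by (subst (asm) multisets.simps; simp split: if_splits)+
  show ?case
  proof (cases k)
    case 0
    show ?thesis
    proof (cases ms)
      case Nil
      then show ?thesis using now prems(2,5) 0 by simp
    next
      case (Cons x xs)
      then obtain i where i: "j = Suc i" using prems(2) by auto
      have "ok (run ((step ^^ x) (rescale u)) xs) (rev xs @ (0 + x) # (m # es))"
        using "1.IH"(1)[OF i, of xs x] now prems(2,3,5) Cons i 0 by simp
      then show ?thesis using Cons 0 by simp
    qed
  next
    case (Suc k')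
    obtain l d where ld: "left = Suc l" "c = Suc d" using prems(4,5) Suc by (cases left; cases c) auto
    have "ok (run ((step ^^ k') (step u)) ms) (rev ms @ (Suc m + k') # es)"
    proof (rule "1.IH"(2))
      show "multisets ok cap j l d (Suc m) (step u) es" using later ld by simp
      show "k' + sum_list ms = l" "k' \<le> d" using prems(4,5) ld Suc by auto
    qed (use ld prems now in auto)
    then show ?thesis using Suc by (simp add: funpow_swap1)
  qed
qed

fun all_le :: "nat \<Rightarrow> (nat \<Rightarrow> bool) \<Rightarrow> bool" where
  "all_le 0 P = P 0"
| "all_le (Suc n) P = (if P (Suc n) then all_le n P else False)"

lemma all_le_iff: "all_le n P \<longleftrightarrow> (\<forall>m\<le>n. P m)"
  by (induction n) (auto simp: le_Suc_eq)

text \<open>For \<open>d = 5\<close> the vanishing coefficients are those at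
  \<open>6 - d = 1\<close> and \<open>7 - d = 2\<close>. Scaling by powers of a nonzero root does
  not affect whether they vanish.\<close>

definition ok5 :: "coeffs \<Rightarrow> nat list \<Rightarrow> bool" where
  "ok5 u es = (case u of (x, y, z) \<Rightarrow> if x = O0 then if y = O0 then
    (let q = sum_list (map (\<lambda>m. m * m) es) in
     if q \<le> 16 then True else if q \<le> 32 then 2 \<le> length (filter (\<lambda>m. 4 \<le> m) es) else False)
    else True else True)"

text \<open>For \<open>d = 4\<close> the vanishing coefficients are those at 2 and 3.\<close>

definition ok4 :: "coeffs \<Rightarrow> nat list \<Rightarrow> bool" where
  "ok4 u es = (case u of (x, y, z) \<Rightarrow> if y = O0 then if z = O0 then
    (if sum_list (map (\<lambda>m. m * m) es) \<le> 21 then True else 2 \<le> length (filter (\<lambda>m. 4 \<le> m) es))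
    else True else True)"

text \<open>The root 0 contributes the factor 1, so its multiplicity \<open>n\<close> only uses up
  part of the \<open>13 - 5 = 8\<close> factors. The enumeration then starts at the root 1, with six
  roots to follow.\<close>

lemma check5: "all_le 5 (\<lambda>n. multisets ok5 5 6 (8 - n) 5 0 (O0, O0, O0) [n])"
  by code_simp

lemma check4: "all_le 4 (\<lambda>n. multisets ok4 4 6 (9 - n) 4 0 (O0, O0, O0) [n])"
  by code_simp

section \<open>A generator of the field, and correctness of the enumeration\<close>

lemma field8_generator:
  assumes k: "CARD('k::{field,finite}) = 8"
  obtains z :: "'k::{field,finite}" where "z ^ 3 = z + 1" "UNIV = insert 0 ((\<lambda>i. z ^ i) ` {..<7})" "inj_on (\<lambda>i. z ^ i) {..<7}"
proof -
  have two: "(2::'k) = 0" by (rule field8_pow(1)[OF k])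
  have m: "- t = (t::'k)" for t using two by (metis add_eq_0_iff mult_2 mult_zero_left)
  have "(UNIV :: 'k set) \<noteq> {0, 1}"
  proof
    assume "(UNIV :: 'k set) = {0, 1}"
    then have "CARD('k) = card {0, 1::'k}" by (rule arg_cong)
    then show False using k by simp
  qed
  then obtain x :: 'k where x: "x \<noteq> 0" "x \<noteq> 1" by auto
  have x7: "x ^ 7 = 1" using field8_pow(2)[OF k, of x] power_Suc[of x 7] x(1) by simp
  \<comment> \<open>The factorisation of \<open>X^7 - 1\<close> over \<open>F_2\<close>, written as
    an integer identity with an even correction term.\<close>
  have "(x - 1) * ((x ^ 3 + x + 1) * (x ^ 3 + x ^ 2 + 1)) =
    x ^ 7 - 1 + 2 * (x ^ 4 - x ^ 3) "
    by (simp add: algebra_simps eval_nat_numeral)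
  then have "(x ^ 3 + x + 1) * (x ^ 3 + x ^ 2 + 1) = 0" using x7 two x(2) by simp
  then obtain z :: 'k where z: "z \<noteq> 0" "z \<noteq> 1" "z ^ 3 + z + 1 = 0"
  proof (cases "x ^ 3 + x + 1 = 0")
    case True
    show ?thesis by (rule that[OF x True])
  next
    case False
    then have "x ^ 3 + x ^ 2 + 1 = 0" using \<open>(x ^ 3 + x + 1) * (x ^ 3 + x ^ 2 + 1) = 0\<close> by simp
    \<comment> \<open>The two cubics are reciprocal to each other: if \<open>x\<close> is a root of
      one, \<open>1 / x\<close> is a root of the other.\<close>
    moreover have "(1 / x) ^ 3 + 1 / x + 1 = (x ^ 3 + x ^ 2 + 1) / x ^ 3"
      using x(1) by (simp add: field_simps eval_nat_numeral)
    ultimately show ?thesis using that[of "1 / x"] x by simp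
  qed
  have z7: "z ^ 7 = 1" using field8_pow(2)[OF k, of z] power_Suc[of z 7] z(1) by simp
  have ne: "z ^ d \<noteq> 1" if d: "0 < d" "d < 7" for d
  proof
    assume "z ^ d = 1"
    then have p: "z ^ (d * n) = 1" for n by (simp add: power_mult)
    have p7: "z ^ (7 * n) = 1" for n using z7 by (simp add: power_mult)
    \<comment> \<open>As 7 is prime, \<open>d\<close> has an inverse \<open>i\<close> modulo 7, so
      \<open>z ^ d = 1\<close> and \<open>z ^ 7 = 1\<close> would give \<open>z = 1\<close>.\<close>
    have z1: "z = 1" if "d * i = Suc (7 * j)" for i j
      using p[of i] p7[of j] unfolding that by simp
    consider "d = 1" | "d = 2" | "d = 3" | "d = 4" | "d = 5" | "d = 6" using d by linarith
    then have "z = 1"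
    proof cases
      case 1 show ?thesis by (rule z1[of 1 0]) (simp add: 1)
    next
      case 2 show ?thesis by (rule z1[of 4 1]) (simp add: 2)
    next
      case 3 show ?thesis by (rule z1[of 5 2]) (simp add: 3)
    next
      case 4 show ?thesis by (rule z1[of 2 1]) (simp add: 4)
    next
      case 5 show ?thesis by (rule z1[of 3 2]) (simp add: 5)
    next
      case 6 show ?thesis by (rule z1[of 6 5]) (simp add: 6)
    qed
    then show False using z(2) by simp
  qed
  have inj: "inj_on (\<lambda>i. z ^ i) {..<7}"
  proof (rule linorder_inj_onI)
    fix i j :: nat assume ij: "i < j" "j \<in> {..<7}"
    have "z ^ j = z ^ i * z ^ (j - i)" using ij by (simp flip: power_add)
    then show "z ^ i \<noteq> z ^ j" using ne[of "j - i"] ij z(1) by auto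
  qed auto
  have "card (insert 0 ((\<lambda>i. z ^ i) ` {..<7})) = CARD('k)"
    using z(1) k card_image[OF inj] by (subst card_insert_disjoint) auto
  then have "insert 0 ((\<lambda>i. z ^ i) ` {..<7}) = UNIV" by (intro card_subset_eq) auto
  moreover have "z ^ 3 = z + 1" using z(3) m[of "z + 1"] by (metis add.assoc add_eq_0_iff2)
  ultimately show ?thesis using that inj by blast
qed

definition octval :: "'k::field \<Rightarrow> oct \<Rightarrow> 'k" where
  "octval z x = (case obits x of (p, q, r) \<Rightarrow> of_bool p * z ^ 2 + of_bool q * z + of_bool r)"

lemma octval_O0 [simp]: "octval z O0 = 0" "octval z O1 = 1"
  by (simp_all add: octval_def)

lemma octval_oxor:
  assumes "(2::'k::field) = 0"
  shows "octval z (oxor x y) = octval z x + (octval z y :: 'k)"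
proof -
  have t: "a + a = 0" for a :: 'k using assms by (metis mult_2 mult_zero_left)
  have b: "of_bool (p \<noteq> q) = of_bool p + (of_bool q :: 'k)" for p q using t[of 1] by (cases p; cases q) simp_all
  show ?thesis unfolding octval_def case_prod_beta obits_oxor b by (simp add: algebra_simps)
qed

lemma octval_odiv:
  assumes "(2::'k::field) = 0" "z ^ 3 = z + (1::'k)"
  shows "octval z (odiv x) * z = octval z x"
proof -
  have t: "a + a = 0" for a :: 'k using assms by (metis mult_2 mult_zero_left)
  have t': "a + (a + b) = b" for a b :: 'k using t[of a] by (simp add: add.assoc[symmetric])
  have "z * z * z = z + 1" using assms(2) by (simp add: eval_nat_numeral mult.assoc)
  then show ?thesis by (cases x) (simp_all add: octval_def power2_eq_square algebra_simps t t')
qed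

definition represents :: "'k::field \<Rightarrow> 'k \<Rightarrow> coeffs \<Rightarrow> 'k poly \<Rightarrow> bool" where
  "represents z t u p \<longleftrightarrow> (case u of (a, b, c) \<Rightarrow> coeff p 0 = 1 \<and> coeff p 1 = octval z a * t \<and>
    coeff p 2 = octval z b * t ^ 2 \<and> coeff p 3 = octval z c * t ^ 3)"

lemma represents_step:
  assumes "(2::'k::field) = 0" "represents z t u (p :: 'k poly)"
  shows "represents z t (step u) ([:1, t:] * p)"
  using assms(2) by (cases u) (auto simp: represents_def octval_oxor[OF assms(1)] coeff_pCons
      eval_nat_numeral algebra_simps split: nat.splits)

lemma represents_steps:
  assumes "(2::'k::field) = 0" "represents z t u (p :: 'k poly)"
  shows "represents z t ((step ^^ m) u) ([:1, t:] ^ m * p)"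
  using assms(2)
proof (induction m)
  case (Suc m)
  then show ?case using represents_step[OF assms(1) Suc.IH] by (simp add: mult.assoc del: mult_pCons_left)
qed simp

lemma represents_rescale:
  assumes "(2::'k::field) = 0" "z ^ 3 = z + (1::'k)" "represents z t u p"
  shows "represents z (t * z) (rescale u) p"
proof -
  note d = octval_odiv[OF assms(1,2)]
  have "octval z (odiv (odiv x)) * z ^ 2 = octval z x" for x
    using d[of "odiv x"] d[of x] by (simp add: power2_eq_square mult.assoc[symmetric])
  moreover have "octval z (odiv (odiv (odiv x))) * z ^ 3 = octval z x" for x
    using d[of "odiv (odiv x)"] d[of "odiv x"] d[of x] by (simp add: power3_eq_cube mult.assoc[symmetric])
  ultimately show ?thesis using assms(3) d
    by (cases u) (auto simp: represents_def power_mult_distrib mult.assoc mult.commute mult.left_commute)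
qed

lemma represents_run:
  assumes "(2::'k::field) = 0" "z ^ 3 = z + (1::'k)" "represents z t u p"
  shows "represents z (t * z ^ length ms) (run u ms) ((\<Prod>i<length ms. [:1, t * z ^ Suc i:] ^ (ms ! i)) * p)"
  using assms(3)
proof (induction ms arbitrary: t u p)
  case (Cons m ms)
  have "represents z (t * z) ((step ^^ m) (rescale u)) ([:1, t * z:] ^ m * p)"
    by (intro represents_steps represents_rescale assms(1,2) Cons.prems)
  from Cons.IH[OF this] show ?case
    by (simp add: prod.lessThan_Suc_shift ac_simps del: mult_pCons_left prod.lessThan_Suc)
qed simp

text \<open>The roots are enumerated as \<open>0, 1, z, \<dots>, z\<^sup>6\<close>; the factor of the root \<open>0\<close> is \<open>1\<close>.\<close>

lemma multisets_field8:
  fixes e :: "'k::{field,finite} \<Rightarrow> nat" and f :: "nat \<Rightarrow> nat"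
  assumes k: "CARD('k) = 8"
    and chk: "all_le cap (\<lambda>n. multisets ok cap 6 (N - n) cap 0 (O0, O0, O0) [n])"
    and e: "\<And>t. e t \<le> cap" "sum e UNIV = N"
  obtains z t :: 'k and u es where "t \<noteq> 0" "z ^ 3 = z + 1" "represents z t u (\<Prod>s\<in>UNIV. [:1, s:] ^ e s)"
    "ok u es" "sum_list (map f es) = (\<Sum>s\<in>UNIV. f (e s))"
    "length (filter P es) = card {s. P (e s)}"
proof -
  have two: "(2::'k) = 0" by (rule field8_pow(1)[OF k])
  obtain z :: 'k where z: "z ^ 3 = z + 1" "UNIV = insert 0 ((\<lambda>i. z ^ i) ` {..<7})" "inj_on (\<lambda>i. z ^ i) {..<7}"
    by (rule field8_generator[OF k])
  have z0: "z \<noteq> 0" using z(1) by auto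
  have sumU: "(\<Sum>s\<in>UNIV. g s) = g 0 + (\<Sum>i<7. g (z ^ i))" for g :: "'k \<Rightarrow> nat"
    unfolding z(2) using z0 by (subst sum.insert) (auto simp: sum.reindex[OF z(3)])
  define ms where "ms = map (\<lambda>i. e (z ^ Suc i)) [0..<6]"
  \<comment> \<open>The list as \<open>multisets\<close> has built it at a leaf: latest root first,
    with the start value \<open>[e 0]\<close> at the end.\<close>
  define es where "es = rev ms @ [e 1, e 0]"
  define u where "u = run ((step ^^ e 1) (O0, O0, O0)) ms"
  have sl: "sum_list (map f es) = (\<Sum>s\<in>UNIV. f (e s))" for f :: "nat \<Rightarrow> nat"
    unfolding sumU es_def ms_def by (simp add: numeral_eq_Suc)
  have "multisets ok cap 6 (N - e 0) cap 0 (O0, O0, O0) [e 0]" using chk e(1) by (simp add: all_le_iff)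
  then have ok: "ok u es"
    unfolding u_def es_def
    using multisets_sound[of ok cap 6 "N - e 0" cap 0 "(O0, O0, O0)" "[e 0]" ms "e 1"] e(1) e(2) sl[of id]
    by (auto simp: ms_def es_def)
  have "represents z 1 ((step ^^ e 1) (O0, O0, O0)) ([:1, 1:] ^ e 1 * 1)"
    by (rule represents_steps[OF two]) (simp add: represents_def)
  from represents_run[OF two z(1) this, of ms]
  have "represents z (z ^ 6) u ((\<Prod>i<6. [:1, z ^ Suc i:] ^ e (z ^ Suc i)) * [:1, 1:] ^ e 1)"
    by (simp add: u_def ms_def)
  also have "(\<Prod>i<6. [:1, z ^ Suc i:] ^ e (z ^ Suc i)) * [:1, 1:] ^ e 1 = (\<Prod>i<7. [:1, z ^ i:] ^ e (z ^ i))"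
    using prod.lessThan_Suc_shift[of "\<lambda>i. [:1, z ^ i:] ^ e (z ^ i)" 6] by (simp add: ac_simps)
  also have "\<dots> = (\<Prod>s\<in>UNIV. [:1, s:] ^ e s)"
    unfolding z(2) using z0 by (subst prod.insert) (auto simp: prod.reindex[OF z(3)] one_pCons[symmetric])
  finally have rep: "represents z (z ^ 6) u (\<Prod>s\<in>UNIV. [:1, s:] ^ e s)" .
  have "length (filter P es) = sum_list (map (\<lambda>m. if P m then 1 else 0) es)"
    by (induction es) auto
  also have "\<dots> = card {s. P (e s)}" unfolding sl by (simp add: sum.If_cases)
  finally show ?thesis using that[of "z ^ 6" z u es] z0 z(1) rep ok sl by simp
qed

text \<open>Division by \<open>z\<close> preserves the value 0 and permutes the seven nonzero digits
  in one cycle, so it would eventually lead to \<open>O1\<close>, whose value is 1.\<close>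

lemma octval_eq_0:
  assumes "(2::'k::field) = 0" "z ^ 3 = z + (1::'k)"
  shows "octval z x = 0 \<longleftrightarrow> x = O0"
proof
  have t: "a + a = 0" for a :: 'k using assms by (metis mult_2 mult_zero_left)
  have inv: "octval z (odiv x) = 0" if "octval z x = 0" for x
    using octval_odiv[OF assms, of x] that assms(2) by auto
  assume 0: "octval z x = 0"
  show "x = O0"
  proof (rule ccontr)
    assume "x \<noteq> O0"
    then have "\<exists>n. (odiv ^^ n) x = O1"
    proof (cases x)
      case O1 then show ?thesis by (intro exI[of _ 0]) simp
    next
      case O2 then show ?thesis by (intro exI[of _ 1]) simp
    next
      case O3 then show ?thesis by (intro exI[of _ 3]) (simp add: eval_nat_numeral)
    next
      case O4 then show ?thesis by (intro exI[of _ 2]) (simp add: eval_nat_numeral)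
    next
      case O5 then show ?thesis by (intro exI[of _ 6]) (simp add: eval_nat_numeral)
    next
      case O6 then show ?thesis by (intro exI[of _ 4]) (simp add: eval_nat_numeral)
    next
      case O7 then show ?thesis by (intro exI[of _ 5]) (simp add: eval_nat_numeral)
    qed simp
    then obtain n where n: "(odiv ^^ n) x = O1" by blast
    have "octval z ((odiv ^^ n) x) = 0" for n by (induction n) (use 0 inv in auto)
    then show False using n by (metis octval_O0(2) zero_neq_one)
  qed
qed simp

lemma local_types_5:
  fixes e :: "'k::{field,finite} \<Rightarrow> nat"
  assumes k: "CARD('k) = 8" and "\<And>t. e t \<le> 5" "sum e UNIV = 8"
    and "coeff (\<Prod>t\<in>UNIV. [:1, t:] ^ e t) 1 = 0" "coeff (\<Prod>t\<in>UNIV. [:1, t:] ^ e t) 2 = 0"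
  shows "(\<Sum>t\<in>UNIV. e t * e t) \<le> 16 \<or> (\<Sum>t\<in>UNIV. e t * e t) \<le> 32 \<and> 2 \<le> card {t. 4 \<le> e t}"
proof -
  obtain z t :: 'k and u es where *: "t \<noteq> 0" "z ^ 3 = z + 1"
      "represents z t u (\<Prod>s\<in>UNIV. [:1, s:] ^ e s)" "ok5 u es"
      "sum_list (map (\<lambda>m. m * m) es) = (\<Sum>s\<in>UNIV. e s * e s)"
      "length (filter (\<lambda>m. 4 \<le> m) es) = card {s. 4 \<le> e s}"
    by (rule multisets_field8[OF k check5 assms(2,3)])
  obtain x y w where u: "u = (x, y, w)" by (cases u)
  have "octval z x = 0" "octval z y = 0" using * assms(4,5) by (auto simp: represents_def u)
  then have "x = O0" "y = O0" using octval_eq_0[OF field8_pow(1)[OF k] *(2)] by auto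
  then show ?thesis using *(4-6) by (auto simp: ok5_def u Let_def split: if_splits)
qed

lemma local_types_4:
  fixes e :: "'k::{field,finite} \<Rightarrow> nat"
  assumes k: "CARD('k) = 8" and "\<And>t. e t \<le> 4" "sum e UNIV = 9"
    and "coeff (\<Prod>t\<in>UNIV. [:1, t:] ^ e t) 2 = 0" "coeff (\<Prod>t\<in>UNIV. [:1, t:] ^ e t) 3 = 0"
  shows "(\<Sum>t\<in>UNIV. e t * e t) \<le> 21 \<or> 2 \<le> card {t. 4 \<le> e t}"
proof -
  obtain z t :: 'k and u es where *: "t \<noteq> 0" "z ^ 3 = z + 1"
      "represents z t u (\<Prod>s\<in>UNIV. [:1, s:] ^ e s)" "ok4 u es"
      "sum_list (map (\<lambda>m. m * m) es) = (\<Sum>s\<in>UNIV. e s * e s)"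
      "length (filter (\<lambda>m. 4 \<le> m) es) = card {s. 4 \<le> e s}"
    by (rule multisets_field8[OF k check4 assms(2,3)])
  obtain x y w where u: "u = (x, y, w)" by (cases u)
  have "octval z y = 0" "octval z w = 0" using * assms(4,5) by (auto simp: represents_def u)
  then have "y = O0" "w = O0" using octval_eq_0[OF field8_pow(1)[OF k] *(2)] by auto
  then show ?thesis using *(4-6) by (auto simp: ok4_def u split: if_splits)
qed

section \<open>The projective plane over a finite field\<close>

fun dot :: "'k::field \<times> 'k \<times> 'k \<Rightarrow> 'k \<times> 'k \<times> 'k \<Rightarrow> 'k" where
  "dot (a, b, c) (x, y, z) = a * x + b * y + c * z"

fun scale :: "'k::field \<Rightarrow> 'k \<times> 'k \<times> 'k \<Rightarrow> 'k \<times> 'k \<times> 'k" where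
  "scale r (x, y, z) = (r * x, r * y, r * z)"

fun cross :: "'k::field \<times> 'k \<times> 'k \<Rightarrow> 'k \<times> 'k \<times> 'k \<Rightarrow> 'k \<times> 'k \<times> 'k" where
  "cross (a, b, c) (x, y, z) = (b * z - c * y, c * x - a * z, a * y - b * x)"

text \<open>One representative for each point, with first nonzero coordinate 1. By duality the same
  triples represent the lines.\<close>

definition pts :: "('k::field \<times> 'k \<times> 'k) set" where
  "pts = range (\<lambda>(a, b). (1, a, b)) \<union> range (\<lambda>a. (0, 1, a)) \<union> {(0, 0, 1)}"

text \<open>As \<open>dot\<close> is symmetric, this is the pencil of a point as well as the set of
  points of a line.\<close>

definition through :: "'k::field \<times> 'k \<times> 'k \<Rightarrow> ('k \<times> 'k \<times> 'k) set" where
  "through p = {l \<in> pts. dot l p = 0}"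

lemma dot_commute: "dot l p = dot p l"
  by (cases l; cases p) (simp add: mult.commute)

lemma dot_add_left: "dot (l + m) p = dot l p + dot m p"
  by (cases l; cases m; cases p) (simp add: algebra_simps)

lemma dot_scale_left: "dot (scale r l) p = r * dot l p"
  by (cases l; cases p) (simp add: algebra_simps)

lemma pts_nonzero: "p \<in> pts \<Longrightarrow> p \<noteq> 0"
  by (auto simp: pts_def zero_prod_def)

lemma finite_pts [simp]: "finite (pts :: ('k::{field,finite} \<times> 'k \<times> 'k) set)"
  by (rule finite)

lemma finite_through [simp]: "finite (through (p :: 'k::{field,finite} \<times> 'k \<times> 'k))"
  by (rule finite)

lemma normalize:
  assumes "v \<noteq> (0 :: 'k::field \<times> 'k \<times> 'k)"
  obtains r p where "r \<noteq> 0" "p \<in> pts" "v = scale r p"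
proof -
  obtain x y z where v: "v = (x, y, z)" by (cases v)
  consider "x \<noteq> 0" | "x = 0" "y \<noteq> 0" | "x = 0" "y = 0" "z \<noteq> 0" using assms v by (auto simp: zero_prod_def)
  then show ?thesis
  proof cases
    case 1 then show ?thesis by (intro that[of x "(1, y / x, z / x)"]) (auto simp: v pts_def)
  next
    case 2 then show ?thesis by (intro that[of y "(0, 1, z / y)"]) (auto simp: v pts_def)
  next
    case 3 then show ?thesis by (intro that[of z "(0, 0, 1)"]) (auto simp: v pts_def)
  qed
qed

lemma cross_eq_0:
  assumes "p \<in> pts" "r \<in> pts" "cross p r = 0"
  shows "p = r"
  using assms by (auto simp: pts_def zero_prod_def)

lemma dot_cross: "dot (cross p r) p = 0" "dot (cross p r) r = 0"
  by (cases p; cases r; simp add: algebra_simps)+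

lemma cross_scale: "cross p (scale r q) = scale r (cross p q)"
  by (cases p; cases q) (simp add: algebra_simps)

lemma scale_eq_0: "scale r p = 0 \<longleftrightarrow> r = 0 \<or> p = 0"
  by (cases p) (auto simp: zero_prod_def)

text \<open>The expansion of the vector triple product.\<close>

lemma cross_cross_eq_0:
  assumes "dot l p = 0" "dot m p = 0"
  shows "cross p (cross l m) = 0"
proof -
  obtain a b c where l: "l = (a, b, c)" by (cases l)
  obtain a' b' c' where m: "m = (a', b', c')" by (cases m)
  obtain x y z where p: "p = (x, y, z)" by (cases p)
  have "cross p (cross l m) = scale (dot m p) l - scale (dot l p) m"
    by (simp add: l m p algebra_simps)
  then show ?thesis using assms by (cases l; cases m) (simp add: zero_prod_def)
qed

lemma line_unique:
  assumes "p \<in> pts" "r \<in> pts" "p \<noteq> r" "l \<in> pts" "m \<in> pts"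
    and "dot l p = 0" "dot l r = 0" "dot m p = 0" "dot m r = 0"
  shows "l = m"
proof (rule ccontr)
  assume "l \<noteq> m"
  then have "cross l m \<noteq> 0" using cross_eq_0 assms(4,5) by blast
  then obtain c q where q: "c \<noteq> 0" "q \<in> pts" "cross l m = scale c q" by (rule normalize)
  have "cross p q = 0" "cross r q = 0"
    using cross_cross_eq_0[OF assms(6,8)] cross_cross_eq_0[OF assms(7,9)] q by (simp_all add: cross_scale scale_eq_0)
  then show False using cross_eq_0 assms(1-3) q(2) by metis
qed

lemma line_exists:
  assumes "p \<in> pts" "r \<in> pts" "p \<noteq> r"
  obtains l where "l \<in> pts" "dot l p = 0" "dot l r = 0"
proof -
  have "cross p r \<noteq> 0" using cross_eq_0 assms by blast
  then obtain c l where l: "c \<noteq> 0" "l \<in> pts" "cross p r = scale c l" by (rule normalize)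
  then show ?thesis using that[of l] dot_cross[of p r] by (simp add: dot_scale_left)
qed

lemma card_lines_two_points:
  assumes "p \<in> pts" "r \<in> pts" "p \<noteq> r"
  shows "card {l \<in> pts. dot l p = 0 \<and> dot l r = 0} = 1"
proof -
  obtain l where l: "l \<in> pts" "dot l p = 0" "dot l r = 0" by (rule line_exists[OF assms])
  then have "{l \<in> pts. dot l p = 0 \<and> dot l r = 0} = {l}" using line_unique[OF assms] by blast
  then show ?thesis by simp
qed

section \<open>Counting points and lines\<close>

lemma sum_pts:
  fixes f :: "'k::{field,finite} \<times> 'k \<times> 'k \<Rightarrow> nat"
  shows "(\<Sum>p\<in>pts. f p) = (\<Sum>a\<in>UNIV. \<Sum>b\<in>UNIV. f (1, a, b)) + (\<Sum>a\<in>UNIV. f (0, 1, a)) + f (0, 0, 1)"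
proof -
  have "sum f (range (Pair 1)) = (\<Sum>x\<in>UNIV \<times> UNIV. f (1, x))"
    by (subst sum.reindex) (auto simp: inj_on_def)
  also have "\<dots> = (\<Sum>a\<in>UNIV. \<Sum>b\<in>UNIV. f (1, a, b))"
    unfolding sum.cartesian_product by (rule sum.cong) auto
  finally have 1: "sum f (range (Pair 1)) = (\<Sum>a\<in>UNIV. \<Sum>b\<in>UNIV. f (1, a, b))" .
  have 2: "(\<Sum>p\<in>range (\<lambda>a. (0, 1, a)). f p) = (\<Sum>a\<in>UNIV. f (0, 1, a))"
    by (subst sum.reindex) (auto simp: inj_on_def)
  show ?thesis unfolding pts_def
    by (subst sum.union_disjoint; (subst sum.union_disjoint)?) (auto simp: 1 2)
qed

lemma card_pts: "card (pts :: ('k::{field,finite} \<times> 'k \<times> 'k) set) = CARD('k) * CARD('k) + CARD('k) + 1"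
  using sum_pts[of "\<lambda>_. 1"] by simp

lemma card_through:
  fixes p :: "'k::{field,finite} \<times> 'k \<times> 'k"
  assumes "p \<noteq> 0"
  shows "card (through p) = CARD('k) + 1"
proof -
  obtain x y z where p: "p = (x, y, z)" by (cases p)
  have "card (through p) = (\<Sum>l\<in>pts. of_bool (dot l p = 0))"
    by (simp add: through_def sum.If_cases of_bool_def Int_def)
  also have "\<dots> = (\<Sum>a\<in>UNIV. \<Sum>b\<in>UNIV. of_bool (x + a * y + b * z = 0)) +
      (\<Sum>a\<in>UNIV. of_bool (y + a * z = 0)) + of_bool (z = 0)"
    unfolding sum_pts by (simp add: p)
  also have "\<dots> = CARD('k) + 1"
  proof -
    have one: "card {a. u + a * v = 0} = 1" if "v \<noteq> 0" for u v :: 'k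
    proof -
      have "u + a * v = 0 \<longleftrightarrow> a = - u / v" for a
        using that by (auto simp: field_simps add_eq_0_iff)
      then show ?thesis by simp
    qed
    consider "z \<noteq> 0" | "z = 0" "y \<noteq> 0" | "z = 0" "y = 0" "x \<noteq> 0" using assms p by (auto simp: zero_prod_def)
    then show ?thesis
    proof cases
      case 1 then show ?thesis by (simp add: one)
    next
      case 2
      have "(\<Sum>a\<in>UNIV. \<Sum>b\<in>(UNIV :: 'k set). of_bool (x + a * y = 0)) =
        CARD('k) * (\<Sum>a\<in>UNIV. of_bool (x + a * y = 0))"
        by (simp add: sum_distrib_left)
      then show ?thesis using 2 one[of y x] by simp
    next
      case 3 then show ?thesis by simp
    qed
  qed
  finally show ?thesis .
qed

text \<open>Every other line meets \<open>l\<close> in exactly one point.\<close>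

lemma sum_through:
  fixes f :: "'k::{field,finite} \<times> 'k \<times> 'k \<Rightarrow> nat"
  assumes l: "l \<in> pts"
  shows "(\<Sum>m\<in>pts - {l}. f m) = (\<Sum>p\<in>through l. \<Sum>m\<in>through p - {l}. f m)"
proof -
  have u: "pts - {l} = (\<Union>p\<in>through l. through p - {l})"
  proof
    show "pts - {l} \<subseteq> (\<Union>p\<in>through l. through p - {l})"
    proof
      fix m assume m: "m \<in> pts - {l}"
      then obtain p where p: "p \<in> pts" "dot p l = 0" "dot p m = 0"
        using line_exists[of l m] l by blast
      have "p \<in> through l" "m \<in> through p - {l}"
        using m p dot_commute[of m p] by (simp_all add: through_def)
      then show "m \<in> (\<Union>p\<in>through l. through p - {l})" by blast
    qed
  qed (auto simp: through_def)
  show ?thesis unfolding u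
  proof (rule sum.UNION_disjoint)
    show "\<forall>p\<in>through l. \<forall>r\<in>through l. p \<noteq> r \<longrightarrow> (through p - {l}) \<inter> (through r - {l}) = {}"
    proof (intro ballI impI)
      fix p r assume pr: "p \<in> through l" "r \<in> through l" "p \<noteq> r"
      have "m = l" if "m \<in> through p" "m \<in> through r" for m
        using line_unique[of p r m l] pr that l by (auto simp: through_def dot_commute)
      then show "(through p - {l}) \<inter> (through r - {l}) = {}" by blast
    qed
  qed auto
qed

text \<open>A point other than \<open>p\<close> lies on one line of the pencil, whereas
  \<open>p\<close> itself lies on all \<open>q + 1\<close> of them.\<close>

lemma sum_count_through:
  fixes p :: "'k::{field,finite} \<times> 'k \<times> 'k"
  assumes p: "p \<in> pts" and N: "set_mset N \<subseteq> pts"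
  shows "(\<Sum>l\<in>through p. size (filter_mset (\<lambda>r. dot l r = 0) N)) = size N + CARD('k) * count N p"
  using N
proof (induction N)
  case (add r N)
  have "(\<Sum>l\<in>through p. size (filter_mset (\<lambda>r. dot l r = 0) (add_mset r N))) =
    (\<Sum>l\<in>through p. of_bool (dot l r = 0)) + (\<Sum>l\<in>through p. size (filter_mset (\<lambda>r. dot l r = 0) N))"
    by (subst sum.distrib[symmetric], intro sum.cong) auto
  also have "(\<Sum>l\<in>through p. of_bool (dot l r = 0)) = card {l \<in> pts. dot l p = 0 \<and> dot l r = 0}"
    by (simp add: through_def of_bool_def sum.If_cases Int_def conj_assoc)
  also have "\<dots> = 1 + CARD('k) * of_bool (p = r)"
    using card_lines_two_points[of p r] card_through[OF pts_nonzero[OF p]] p add.prems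
    by (auto simp: through_def)
  finally show ?case using add by (auto simp: algebra_simps)
qed simp

section \<open>Double blocking sets of size 23 in the plane of order 8\<close>

lemma other_point:
  fixes l :: "'k::{field,finite} \<times> 'k \<times> 'k"
  assumes "l \<in> pts"
  obtains r where "r \<in> through l" "r \<noteq> p"
proof -
  have "card (UNIV :: 'k set) > 0" by simp
  then have "card (through l) > 1" using card_through[OF pts_nonzero[OF assms]] by linarith
  then have "\<not> through l \<subseteq> {p}" using card_mono[of "{p}" "through l"] by auto
  then show ?thesis using that by blast
qed

text \<open>\<open>line t\<close> is the normal form of \<open>m - t l\<close>. A second point on
  such a line is off \<open>l\<close> and determines \<open>t\<close>; injectivity and a count then
  give all lines of the pencil except \<open>l\<close>.\<close>

lemma pencil:
  fixes p :: "'k::{field,finite} \<times> 'k \<times> 'k"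
  assumes p: "p \<in> pts" and l: "l \<in> through p" and m: "m \<in> through p" "m \<noteq> l"
  obtains line where "bij_betw line UNIV (through p - {l})"
    "\<And>t r. dot (line t) r = 0 \<longleftrightarrow> dot m r = t * dot l r"
proof -
  have lm: "l \<in> pts" "m \<in> pts" "dot l p = 0" "dot m p = 0" using l m by (auto simp: through_def)
  have "\<exists>n. n \<in> pts \<and> (\<forall>r. dot n r = 0 \<longleftrightarrow> dot m r = t * dot l r)" for t
  proof -
    have "m + scale (- t) l \<noteq> 0"
    proof
      assume "m + scale (- t) l = 0"
      then have "m = scale t l" by (cases m; cases l) (auto simp: zero_prod_def add_eq_0_iff)
      then have "cross l m = scale t (cross l l)" by (simp add: cross_scale)
      also have "\<dots> = 0" by (cases l) (simp add: zero_prod_def)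
      finally show False using cross_eq_0[OF lm(1,2)] m(2) by simp
    qed
    then obtain c n where n: "c \<noteq> 0" "n \<in> pts" "m + scale (- t) l = scale c n" by (rule normalize)
    have "dot m r - t * dot l r = c * dot n r" for r
      using arg_cong[OF n(3), of "\<lambda>v. dot v r"] by (simp add: dot_add_left dot_scale_left)
    then have "dot n r = 0 \<longleftrightarrow> dot m r = t * dot l r" for r using n(1)
      by (metis eq_iff_diff_eq_0 mult_eq_0_iff)
    then show ?thesis using n(2) by blast
  qed
  then obtain line where line: "\<And>t. line t \<in> pts" "\<And>t r. dot (line t) r = 0 \<longleftrightarrow> dot m r = t * dot l r"
    by metis
  have thr: "line t \<in> through p" for t using line[of t] lm by (simp add: through_def)
  have off: "dot l r \<noteq> 0" if "r \<in> through (line t)" "r \<noteq> p" for r t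
  proof
    assume lr: "dot l r = 0"
    have r: "r \<in> pts" "dot (line t) r = 0" using that by (auto simp: through_def dot_commute)
    then have "dot m r = 0" using line(2)[of t r] lr by simp
    then show False using line_unique[of p r l m] p r lm lr m(2) that(2) by auto
  qed
  have ne: "line t \<noteq> l" for t
  proof
    assume eq: "line t = l"
    obtain r where r: "r \<in> through (line t)" "r \<noteq> p" using other_point[OF line(1)] .
    then have "dot l r = 0" using eq by (simp add: through_def dot_commute)
    then show False using off[OF r] by simp
  qed
  have inj: "inj line"
  proof (rule injI)
    fix s t assume eq: "line s = line t"
    obtain r where r: "r \<in> through (line t)" "r \<noteq> p" using other_point[OF line(1)] .
    then have "dot (line t) r = 0" "dot (line s) r = 0" using eq by (simp_all add: through_def dot_commute)
    then have "s * dot l r = t * dot l r" using line(2) by metis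
    then show "s = t" using off[OF r] by simp
  qed
  have "range line = through p - {l}"
  proof (rule card_subset_eq)
    show "range line \<subseteq> through p - {l}" using thr ne by blast
    show "card (range line) = card (through p - {l})"
      using card_image[OF inj] card_through[OF pts_nonzero[OF p]] l by simp
  qed simp
  then show ?thesis using that[of line] inj line(2) by (simp add: bij_betw_def)
qed

lemma exists_dot_1:
  assumes "p \<noteq> (0 :: 'k::field \<times> 'k \<times> 'k)"
  obtains w where "dot w p = 1"
proof -
  obtain x y z where p: "p = (x, y, z)" by (cases p)
  consider "x \<noteq> 0" | "y \<noteq> 0" | "z \<noteq> 0" using assms p by (auto simp: zero_prod_def)
  then show ?thesis
  proof cases
    case 1 then show ?thesis by (intro that[of "(1 / x, 0, 0)"]) (simp add: p)
  next
    case 2 then show ?thesis by (intro that[of "(0, 1 / y, 0)"]) (simp add: p)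
  next
    case 3 then show ?thesis by (intro that[of "(0, 0, 1 / z)"]) (simp add: p)
  qed
qed

section \<open>Excesses of the lines of a hypothetical double blocking set\<close>

locale double_blocking =
  fixes B :: "('k::{field,finite} \<times> 'k \<times> 'k) set"
  assumes k: "CARD('k) = 8" and B: "B \<subseteq> pts" "card B = 23"
    and blocking: "\<And>l. l \<in> pts \<Longrightarrow> 2 \<le> card {r \<in> B. dot l r = 0}"
begin

definition meet :: "'k \<times> 'k \<times> 'k \<Rightarrow> nat" where
  "meet l = card {r \<in> B. dot l r = 0}"

definition excess :: "'k \<times> 'k \<times> 'k \<Rightarrow> nat" where
  "excess l = meet l - 2"

lemma finB: "finite B" by (rule finite)

lemma meet_eq: "l \<in> pts \<Longrightarrow> meet l = excess l + 2"
  using blocking[of l] by (simp add: meet_def excess_def)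

lemma card_thr: "p \<in> pts \<Longrightarrow> card (through p) = 9" for p :: "'k \<times> 'k \<times> 'k"
  using card_through[OF pts_nonzero, of p] k by simp

lemma sum_meet_through:
  assumes "p \<in> pts"
  shows "(\<Sum>l\<in>through p. meet l) = 23 + 8 * of_bool (p \<in> B)"
  using sum_count_through[OF assms, of "mset_set B"] B k finB
  by (simp add: meet_def filter_mset_mset_set size_mset_set count_mset_set')

lemma sum_excess_through:
  assumes "p \<in> pts"
  shows "(\<Sum>l\<in>through p. excess l) = 5 + 8 * of_bool (p \<in> B)"
proof -
  have "(\<Sum>l\<in>through p. meet l) = (\<Sum>l\<in>through p. excess l + 2)"
    by (intro sum.cong) (auto simp: meet_eq through_def)
  also have "\<dots> = (\<Sum>l\<in>through p. excess l) + 18"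
    unfolding sum.distrib using card_thr[OF assms] by simp
  finally show ?thesis using sum_meet_through[OF assms] by auto
qed

lemma sum_excess_others:
  assumes "p \<in> pts" "l \<in> through p"
  shows "(\<Sum>m\<in>through p - {l}. excess m) + excess l = 5 + 8 * of_bool (p \<in> B)"
  using sum_excess_through[OF assms(1)] sum.remove[OF finite_through assms(2), of excess] by simp

lemma double_count: "(\<Sum>l\<in>pts. meet l * g l) = (\<Sum>r\<in>B. \<Sum>l\<in>through r. g l)"
proof -
  have "(\<Sum>l\<in>pts. meet l * g l) = (\<Sum>l\<in>pts. \<Sum>r\<in>{r \<in> B. dot l r = 0}. g l)"
    by (simp add: meet_def)
  also have "\<dots> = (\<Sum>r\<in>B. \<Sum>l\<in>{l \<in> pts. dot l r = 0}. g l)"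
    by (rule sum.swap_restrict) (simp_all add: finB)
  finally show ?thesis by (simp add: through_def)
qed

lemma sum_meet: "(\<Sum>l\<in>pts. meet l) = 207"
proof -
  have "(\<Sum>l\<in>pts. meet l) = (\<Sum>r\<in>B. 9)"
    using double_count[of "\<lambda>_. 1"] card_thr B(1) by (simp add: subset_eq del: split_paired_All)
  then show ?thesis using B(2) by simp
qed

lemma sum_meet_sq: "(\<Sum>l\<in>pts. meet l * meet l) = 713"
proof -
  \<comment> \<open>On the lines through a point of \<open>B\<close> there are
    \<open>23 + 8 = 31\<close> incidences with \<open>B\<close>.\<close>
  have "(\<Sum>l\<in>pts. meet l * meet l) = (\<Sum>r\<in>B. 31)"
    unfolding double_count using B(1) by (intro sum.cong) (auto simp: sum_meet_through)
  then show ?thesis using B(2) by simp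
qed

lemma card_pts_73: "card (pts :: ('k \<times> 'k \<times> 'k) set) = 73"
  using card_pts[where 'k = 'k] k by simp

lemma sum_excess: "(\<Sum>l\<in>pts. excess l) = 61"
proof -
  have "(\<Sum>l\<in>pts. meet l) = (\<Sum>l\<in>pts. excess l + 2)" by (intro sum.cong) (auto simp: meet_eq)
  also have "\<dots> = (\<Sum>l\<in>pts. excess l) + 146" unfolding sum.distrib using card_pts_73 by simp
  finally show ?thesis using sum_meet by simp
qed

lemma sum_excess_sq: "(\<Sum>l\<in>pts. excess l * excess l) = 177"
proof -
  have "(\<Sum>l\<in>pts. meet l * meet l) = (\<Sum>l\<in>pts. excess l * excess l + 4 * excess l + 4)"
    by (intro sum.cong) (auto simp: meet_eq algebra_simps)
  then show ?thesis using sum_meet_sq sum_excess card_pts_73 by (simp add: sum.distrib sum_distrib_left[symmetric])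
qed

lemma sum_excess_sq_points:
  assumes "l \<in> pts"
  shows "(\<Sum>p\<in>through l. \<Sum>m\<in>through p - {l}. excess m * excess m) + excess l * excess l = 177"
  using sum_through[OF assms, of "\<lambda>m. excess m * excess m"] sum_excess_sq
    sum.remove[OF finite_pts assms, of "\<lambda>m. excess m * excess m"] by simp

text \<open>The linear forms \<open>dot l\<close>, \<open>dot m\<close> and \<open>dot w\<close>
  with \<open>dot w p = 1\<close> serve as coordinates in which \<open>p\<close> becomes
  \<open>(0, 0, 1)\<close>, so no change of basis is carried out.\<close>

lemma local_structure:
  assumes p: "p \<in> B" and l: "l \<in> through p"
  obtains line :: "'k \<Rightarrow> 'k \<times> 'k \<times> 'k" where "bij_betw line UNIV (through p - {l})" "excess l \<le> 5"
    "coeff (\<Prod>t\<in>UNIV. [:1, t:] ^ excess (line t)) (6 - excess l) = 0"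
    "coeff (\<Prod>t\<in>UNIV. [:1, t:] ^ excess (line t)) (7 - excess l) = 0"
proof -
  have pp: "p \<in> pts" using p B by auto
  have lp: "l \<in> pts" "dot l p = 0" using l by (auto simp: through_def)
  have "card {l} < card (through p)" using card_thr[OF pp] by simp
  then have "\<not> through p \<subseteq> {l}" using card_mono[of "{l}" "through p"] by auto
  then obtain m where m: "m \<in> through p" "m \<noteq> l" by blast
  have mp: "m \<in> pts" "dot m p = 0" using m by (auto simp: through_def)
  obtain line where line: "bij_betw line UNIV (through p - {l})"
    "\<And>t r. dot (line t) r = 0 \<longleftrightarrow> dot m r = t * dot l r"
    using pencil[OF pp l m] by blast
  have lt: "line t \<in> pts" "dot (line t) p = 0" for t
    using bij_betwE[OF line(1)] by (auto simp: through_def)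
  obtain w where w: "dot w p = 1" using exists_dot_1[OF pts_nonzero[OF pp]] .
  define I where "I = B - {p}"
  have I: "finite I" "card I = 22" using p B(2) finB by (simp_all add: I_def)
  have remove: "card {r \<in> I. dot n r = 0} = excess n + 1" if "n \<in> pts" "dot n p = 0" for n
  proof -
    have "{r \<in> B. dot n r = 0} = insert p {r \<in> I. dot n r = 0}" using p that by (auto simp: I_def)
    then have "meet n = Suc (card {r \<in> I. dot n r = 0})" unfolding meet_def by (simp add: I_def)
    then show ?thesis using meet_eq[OF that(1)] by simp
  qed
  have nz: "dot m r \<noteq> 0" if "r \<in> I" "dot l r = 0" for r
  proof
    assume "dot m r = 0"
    moreover have "r \<in> pts" "p \<noteq> r" using that B by (auto simp: I_def)
    ultimately show False using line_unique[OF pp _ _ lp(1) mp(1) lp(2) that(2) mp(2)] m(2) by auto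
  qed
  \<comment> \<open>The triple \<open>x l + y m + w\<close> represents a line that misses
    \<open>p\<close>, so its two points of \<open>B\<close> lie in \<open>I\<close>.\<close>
  have cover: "\<exists>i\<in>I. \<exists>j\<in>I. i \<noteq> j \<and> dot l i * x + dot m i * y + dot w i = 0 \<and> dot l j * x + dot m j * y + dot w j = 0"
    for x y
  proof -
    let ?v = "scale x l + scale y m + w"
    have d: "dot ?v r = dot l r * x + dot m r * y + dot w r" for r
      by (simp add: dot_add_left dot_scale_left mult.commute)
    have v1: "dot ?v p = 1" unfolding d using lp mp w by simp
    moreover have "dot 0 p = 0" by (cases p) (simp add: zero_prod_def)
    ultimately have "?v \<noteq> 0" by (metis zero_neq_one)
    then obtain c n where n: "c \<noteq> 0" "n \<in> pts" "?v = scale c n" by (rule normalize)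
    have n0: "dot ?v r = 0" if "dot n r = 0" for r using n(3) that by (simp add: dot_scale_left)
    have "2 \<le> card {r \<in> B. dot n r = 0}" using blocking[OF n(2)] .
    moreover have "{r \<in> B. dot n r = 0} \<subseteq> {r \<in> I. dot ?v r = 0}" using n0 v1 by (auto simp: I_def)
    ultimately have "2 \<le> card {r \<in> I. dot ?v r = 0}"
      using card_mono[of "{r \<in> I. dot ?v r = 0}" "{r \<in> B. dot n r = 0}"] I(1) by simp
    then obtain T where T: "T \<subseteq> {r \<in> I. dot ?v r = 0}" "card T = 2"
      by (rule obtain_subset_with_card_n)
    obtain i j where "T = {i, j}" "i \<noteq> j" using T(2) by (auto simp: card_2_iff)
    then have "i \<in> I" "j \<in> I" "i \<noteq> j" "dot ?v i = 0" "dot ?v j = 0" using T(1) by auto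
    then show ?thesis unfolding d by blast
  qed
  have d: "card {i \<in> I. dot l i = 0} = excess l + 1" using remove[OF lp] .
  have e: "card {i \<in> I. dot l i \<noteq> 0 \<and> dot m i = t * dot l i} = excess (line t) + 1" for t
  proof -
    have "{i \<in> I. dot l i \<noteq> 0 \<and> dot m i = t * dot l i} = {i \<in> I. dot (line t) i = 0}"
      unfolding line(2) using nz by auto
    then show ?thesis using remove[OF lt] by simp
  qed
  \<comment> \<open>A line has 9 points in all, so its excess is at most 7.\<close>
  have "card {r \<in> B. dot l r = 0} \<le> card (through l)"
    using B by (intro card_mono) (auto simp: through_def dot_commute)
  then have d7: "excess l \<le> 7" using card_thr[OF lp(1)] by (simp add: excess_def meet_def)
  note loc = double_cover_local[OF k I, where a = "dot l" and b = "dot m" and c = "dot w" and d = "excess l"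
      and e = "\<lambda>t. excess (line t)"]
  show ?thesis
  proof (rule that[OF line(1)])
    show "excess l \<le> 5" by (rule loc(1)) (use cover nz d d7 e in blast)+
    show "coeff (\<Prod>t\<in>UNIV. [:1, t:] ^ excess (line t)) (6 - excess l) = 0"
      by (rule loc(3)) (use cover nz d d7 e in blast)+
    show "coeff (\<Prod>t\<in>UNIV. [:1, t:] ^ excess (line t)) (7 - excess l) = 0"
      by (rule loc(4)) (use cover nz d d7 e in blast)+
  qed
qed

section \<open>Lines of excess five and four\<close>

lemma sum_line_bij:
  assumes "bij_betw line UNIV (through p - {l})"
  shows "(\<Sum>t\<in>UNIV. f (line t)) = (\<Sum>m\<in>through p - {l}. (f m :: nat))"
  using sum.reindex_bij_betw[OF assms] .

lemma card_line_bij: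
  assumes "bij_betw line UNIV (through p - {l})"
  shows "card {t. P (line t)} = card {m \<in> through p - {l}. P m}"
proof -
  have "line ` {t. P (line t)} = {m \<in> through p - {l}. P m}"
    unfolding bij_betw_imp_surj_on[OF assms, symmetric] by blast
  moreover have "inj_on line {t. P (line t)}" using assms by (auto simp: bij_betw_def inj_on_def)
  ultimately show ?thesis by (metis card_image)
qed

lemma excess_le_5:
  assumes "l \<in> pts"
  shows "excess l \<le> 5"
proof -
  have "{r \<in> B. dot l r = 0} \<noteq> {}" using blocking[OF assms] by (metis card.empty not_numeral_le_zero)
  then obtain p where "p \<in> B" "dot l p = 0" by blast
  then have "l \<in> through p" using assms by (simp add: through_def)
  then show ?thesis using local_structure[OF \<open>p \<in> B\<close>] by blast
qed

lemma types_5: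
  assumes p: "p \<in> B" and l: "l \<in> through p" and e: "excess l = 5"
  shows "(\<Sum>m\<in>through p - {l}. excess m * excess m) \<le> 16 \<or>
    (\<Sum>m\<in>through p - {l}. excess m * excess m) \<le> 32 \<and> 2 \<le> card {m \<in> through p - {l}. 4 \<le> excess m}"
proof -
  have pp: "p \<in> pts" using p B by auto
  obtain line :: "'k \<Rightarrow> 'k \<times> 'k \<times> 'k" where line: "bij_betw line UNIV (through p - {l})"
    "coeff (\<Prod>t\<in>UNIV. [:1, t:] ^ excess (line t)) (6 - excess l) = 0"
    "coeff (\<Prod>t\<in>UNIV. [:1, t:] ^ excess (line t)) (7 - excess l) = 0"
    using local_structure[OF p l] by blast
  have "excess (line t) \<le> 5" for t
    using bij_betwE[OF line(1)] by (intro excess_le_5) (auto simp: through_def)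
  moreover have "(\<Sum>t\<in>UNIV. excess (line t)) = 8"
    unfolding sum_line_bij[OF line(1)] using sum_excess_others[OF pp l] p e by simp
  ultimately show ?thesis
    using local_types_5[OF k, of "\<lambda>t. excess (line t)"] line(2,3) e
    unfolding sum_line_bij[OF line(1), of "\<lambda>m. excess m * excess m"] card_line_bij[OF line(1), of "\<lambda>m. 4 \<le> excess m"]
    by (simp add: numeral_2_eq_2)
qed

text \<open>Applied once excess 5 has been excluded, which justifies the cap 4 of the
  enumeration.\<close>

lemma types_4:
  assumes p: "p \<in> B" and l: "l \<in> through p" and e: "excess l = 4" and le: "\<And>m. m \<in> pts \<Longrightarrow> excess m \<le> 4"
  shows "(\<Sum>m\<in>through p - {l}. excess m * excess m) \<le> 21 \<or> 2 \<le> card {m \<in> through p - {l}. 4 \<le> excess m}"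
proof -
  have pp: "p \<in> pts" using p B by auto
  obtain line :: "'k \<Rightarrow> 'k \<times> 'k \<times> 'k" where line: "bij_betw line UNIV (through p - {l})"
    "coeff (\<Prod>t\<in>UNIV. [:1, t:] ^ excess (line t)) (6 - excess l) = 0"
    "coeff (\<Prod>t\<in>UNIV. [:1, t:] ^ excess (line t)) (7 - excess l) = 0"
    using local_structure[OF p l] by blast
  have "excess (line t) \<le> 4" for t
    using bij_betwE[OF line(1)] by (intro le) (auto simp: through_def)
  moreover have "(\<Sum>t\<in>UNIV. excess (line t)) = 9"
    unfolding sum_line_bij[OF line(1)] using sum_excess_others[OF pp l] p e by simp
  ultimately show ?thesis
    using local_types_4[OF k, of "\<lambda>t. excess (line t)"] line(2,3) e
    unfolding sum_line_bij[OF line(1), of "\<lambda>m. excess m * excess m"] card_line_bij[OF line(1), of "\<lambda>m. 4 \<le> excess m"]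
    by simp
qed

text \<open>The exceptional points of \<open>types_5\<close> and \<open>types_4\<close>, where the
  sum of squares may be large.\<close>

definition rich :: "'k \<times> 'k \<times> 'k \<Rightarrow> ('k \<times> 'k \<times> 'k) set" where
  "rich l = {p \<in> B. l \<in> through p \<and> 2 \<le> card {m \<in> through p - {l}. 4 \<le> excess m}}"

lemma mem_through_commute: "p \<in> pts \<Longrightarrow> l \<in> pts \<Longrightarrow> l \<in> through p \<longleftrightarrow> p \<in> through l"
  by (simp add: through_def dot_commute)

lemma meet_through:
  assumes "l \<in> pts"
  shows "{r \<in> B. dot l r = 0} = B \<inter> through l"
  using B(1) by (auto simp: through_def dot_commute)

text \<open>The line \<open>m\<close> carries at least 6 points of \<open>B\<close>, and only
  \<open>p\<close> among them is on \<open>l\<close>.\<close>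

lemma card_off:
  assumes p: "p \<in> B" and l: "l \<in> through p" and m: "m \<in> through p - {l}" and e: "4 \<le> excess m"
  shows "5 \<le> card (B \<inter> through m - through l)"
proof -
  have pts: "p \<in> pts" "l \<in> pts" "m \<in> pts" using p B l m by (auto simp: through_def)
  have "B \<inter> through m \<subseteq> insert p (B \<inter> through m - through l)"
  proof
    fix r assume r: "r \<in> B \<inter> through m"
    show "r \<in> insert p (B \<inter> through m - through l)"
    proof (cases "r \<in> through l")
      case True
      then have "r = p"
        using line_unique[OF pts(2,3), of p r] r m l pts by (auto simp: through_def dot_commute)
      then show ?thesis by simp
    qed (use r in simp)
  qed
  then have "card (B \<inter> through m) \<le> card (insert p (B \<inter> through m - through l))"
    by (intro card_mono) simp_all
  also have "\<dots> \<le> Suc (card (B \<inter> through m - through l))" by (rule card_insert_le_m1[simplified]) simp_all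
  finally show ?thesis using meet_eq[OF pts(3)] e by (simp add: meet_def meet_through[OF pts(3)])
qed

lemma card_common_le_1:
  assumes "m \<in> pts" "n \<in> pts" "m \<noteq> n"
  shows "card (through m \<inter> through n) \<le> 1"
proof -
  have "{l \<in> pts. dot l m = 0 \<and> dot l n = 0} = through m \<inter> through n" by (auto simp: through_def)
  then show ?thesis using card_lines_two_points[OF assms] by simp
qed

text \<open>Two lines through \<open>p\<close> share no other point, so their parts off
  \<open>l\<close> are disjoint and have at least 5 points each.\<close>

lemma rich_pair:
  assumes p: "p \<in> rich l"
  obtains m n where "m \<in> through p - {l}" "n \<in> through p - {l}" "m \<noteq> n"
    "10 \<le> card ((B \<inter> through m - through l) \<union> (B \<inter> through n - through l))"
proof -
  have pB: "p \<in> B" "l \<in> through p" using p by (auto simp: rich_def)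
  have "2 \<le> card {m \<in> through p - {l}. 4 \<le> excess m}" using p by (simp add: rich_def)
  then obtain T where T: "T \<subseteq> {m \<in> through p - {l}. 4 \<le> excess m}" "card T = 2"
    by (rule obtain_subset_with_card_n)
  obtain m n where mn: "T = {m, n}" "m \<noteq> n" using T(2) by (auto simp: card_2_iff)
  have *: "m \<in> through p - {l}" "n \<in> through p - {l}" "4 \<le> excess m" "4 \<le> excess n" using T(1) mn by auto
  have pts: "p \<in> pts" "l \<in> pts" "m \<in> pts" "n \<in> pts" using pB B * by (auto simp: through_def)
  have "r = p" if "r \<in> through m" "r \<in> through n" for r
    using line_unique[OF pts(3,4) mn(2), of r p] that * pts by (auto simp: through_def dot_commute)
  then have "(B \<inter> through m - through l) \<inter> (B \<inter> through n - through l) = {}"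
    using pB(2) mem_through_commute[OF pts(1,2)] by blast
  then have "card ((B \<inter> through m - through l) \<union> (B \<inter> through n - through l)) =
    card (B \<inter> through m - through l) + card (B \<inter> through n - through l)"
    by (intro card_Un_disjoint) simp_all
  then show ?thesis using that[OF *(1,2) mn(2)] card_off[OF pB *(1,3)] card_off[OF pB *(2,4)] by simp
qed

lemma card_Int_Un_le: "card ((X \<union> Y) \<inter> (Z \<union> W)) \<le> card (X \<inter> Z) + card (X \<inter> W) + card (Y \<inter> Z) + card (Y \<inter> W)"
proof -
  have eq: "(X \<union> Y) \<inter> (Z \<union> W) = (X \<inter> Z \<union> X \<inter> W) \<union> (Y \<inter> Z \<union> Y \<inter> W)" by blast
  show ?thesis unfolding eq
    using card_Un_le[of "X \<inter> Z \<union> X \<inter> W" "Y \<inter> Z \<union> Y \<inter> W"] card_Un_le[of "X \<inter> Z" "X \<inter> W"]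
      card_Un_le[of "Y \<inter> Z" "Y \<inter> W"] by linarith
qed

text \<open>Three rich points on \<open>l\<close> would give six lines that cover at least \<open>10 + 6 + 2\<close> of the at
  most \<open>17\<close> points of \<open>B\<close> off \<open>l\<close>.\<close>

lemma card_rich_le:
  assumes l: "l \<in> pts" and e: "4 \<le> excess l"
  shows "card (rich l) \<le> 2"
proof (rule ccontr)
  assume "\<not> card (rich l) \<le> 2"
  then have "3 \<le> card (rich l)" by simp
  then obtain T where T: "T \<subseteq> rich l" "card T = 3" by (rule obtain_subset_with_card_n)
  then obtain p q r where pqr: "T = {p, q, r}" "p \<noteq> q" "p \<noteq> r" "q \<noteq> r" by (auto simp: card_3_iff)
  define off where "off m = B \<inter> through m - through l" for m
  have T': "p \<in> rich l" "q \<in> rich l" "r \<in> rich l" using T(1) pqr(1) by auto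
  obtain m1 m2 where m: "m1 \<in> through p - {l}" "m2 \<in> through p - {l}" "m1 \<noteq> m2" "10 \<le> card (off m1 \<union> off m2)"
    unfolding off_def by (rule rich_pair[OF T'(1)])
  obtain n1 n2 where n: "n1 \<in> through q - {l}" "n2 \<in> through q - {l}" "n1 \<noteq> n2" "10 \<le> card (off n1 \<union> off n2)"
    unfolding off_def by (rule rich_pair[OF T'(2)])
  obtain k1 k2 where k: "k1 \<in> through r - {l}" "k2 \<in> through r - {l}" "k1 \<noteq> k2" "10 \<le> card (off k1 \<union> off k2)"
    unfolding off_def by (rule rich_pair[OF T'(3)])
  have rich: "x \<in> pts" "l \<in> through x" if "x \<in> T" for x using that T(1) B by (auto simp: rich_def)
  have inter: "card (off x \<inter> off y) \<le> 1" if "x \<in> through u - {l}" "y \<in> through v - {l}" "u \<in> T" "v \<in> T" "u \<noteq> v"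
    for x y u v
  proof -
    have xy: "x \<in> pts" "y \<in> pts" using that by (auto simp: through_def)
    have "x \<noteq> y"
    proof
      assume "x = y"
      then have "x = l" using line_unique[OF rich(1)[OF that(3)] rich(1)[OF that(4)] that(5) xy(1) l] that
          rich(2)[OF that(3)] rich(2)[OF that(4)] by (auto simp: through_def)
      then show False using that(1) by simp
    qed
    then have "card (through x \<inter> through y) \<le> 1" by (rule card_common_le_1[OF xy])
    moreover have "card (off x \<inter> off y) \<le> card (through x \<inter> through y)"
      by (rule card_mono) (auto simp: off_def)
    ultimately show ?thesis by simp
  qed
  note i = inter[OF _ _ _ _ pqr(2)] inter[OF _ _ _ _ pqr(3)] inter[OF _ _ _ _ pqr(4)]
  let ?X = "off m1 \<union> off m2" and ?Y = "off n1 \<union> off n2" and ?Z = "off k1 \<union> off k2"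
  have mem: "p \<in> T" "q \<in> T" "r \<in> T" using pqr by auto
  have XY: "card (?X \<inter> ?Y) \<le> 4"
    using card_Int_Un_le[of "off m1" "off m2" "off n1" "off n2"]
      i(1)[OF m(1) n(1) mem(1,2)] i(1)[OF m(1) n(2) mem(1,2)] i(1)[OF m(2) n(1) mem(1,2)] i(1)[OF m(2) n(2) mem(1,2)]
    by linarith
  have XZ: "card (?X \<inter> ?Z) \<le> 4"
    using card_Int_Un_le[of "off m1" "off m2" "off k1" "off k2"]
      i(2)[OF m(1) k(1) mem(1,3)] i(2)[OF m(1) k(2) mem(1,3)] i(2)[OF m(2) k(1) mem(1,3)] i(2)[OF m(2) k(2) mem(1,3)]
    by linarith
  have YZ: "card (?Y \<inter> ?Z) \<le> 4"
    using card_Int_Un_le[of "off n1" "off n2" "off k1" "off k2"]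
      i(3)[OF n(1) k(1) mem(2,3)] i(3)[OF n(1) k(2) mem(2,3)] i(3)[OF n(2) k(1) mem(2,3)] i(3)[OF n(2) k(2) mem(2,3)]
    by linarith
  have fin: "finite ?X" "finite ?Y" "finite ?Z" by simp_all
  have "card (?X \<union> ?Y) + card (?X \<inter> ?Y) = card ?X + card ?Y" using card_Un_Int[OF fin(1,2)] by simp
  then have 16: "16 \<le> card (?X \<union> ?Y)" using XY m(4) n(4) by linarith
  have "card ((?X \<union> ?Y) \<inter> ?Z) \<le> card (?X \<inter> ?Z) + card (?Y \<inter> ?Z)"
    using card_Un_le[of "?X \<inter> ?Z" "?Y \<inter> ?Z"] by (simp only: Int_Un_distrib2)
  moreover have "card (?X \<union> ?Y \<union> ?Z) + card ((?X \<union> ?Y) \<inter> ?Z) = card (?X \<union> ?Y) + card ?Z"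
    using card_Un_Int[of "?X \<union> ?Y" ?Z] fin by simp
  ultimately have "18 \<le> card (?X \<union> ?Y \<union> ?Z)" using 16 XZ YZ k(4) by linarith
  also have "\<dots> \<le> card (B - B \<inter> through l)" by (rule card_mono) (auto simp: off_def)
  also have "\<dots> = 23 - meet l" using B(2) by (simp add: card_Diff_subset meet_def meet_through[OF l])
  finally show False using meet_eq[OF l] e by simp
qed

section \<open>The final count along a line\<close>

definition others :: "'k \<times> 'k \<times> 'k \<Rightarrow> 'k \<times> 'k \<times> 'k \<Rightarrow> nat" where
  "others l p = (\<Sum>m\<in>through p - {l}. excess m * excess m)"

text \<open>Of the 9 points of \<open>l\<close>, \<open>excess l + 2\<close> are in
  \<open>B\<close>. The bounds \<open>a\<close>, \<open>b\<close> and \<open>b + c\<close> are for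
  points outside \<open>B\<close>, ordinary points of \<open>B\<close> and rich points.\<close>

lemma sum_others_le:
  assumes l: "l \<in> pts"
    and out: "\<And>p. p \<in> through l \<Longrightarrow> p \<notin> B \<Longrightarrow> others l p \<le> a"
    and ins: "\<And>p. p \<in> through l \<Longrightarrow> p \<in> B \<Longrightarrow> others l p \<le> b + c * of_bool (p \<in> rich l)"
  shows "177 \<le> excess l * excess l + a * (7 - excess l) + b * (excess l + 2) + c * card (rich l)"
proof -
  have card_in: "card (through l \<inter> B) = excess l + 2"
    using meet_eq[OF l] by (simp add: meet_def meet_through[OF l] Int_commute)
  have "card (through l - B) = card (through l) - card (through l \<inter> B)" by (rule card_Diff_subset_Int) simp
  then have card_out: "card (through l - B) = 7 - excess l" using card_thr[OF l] card_in by simp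
  have "(\<Sum>p\<in>through l. others l p) = (\<Sum>p\<in>through l - B. others l p) + (\<Sum>p\<in>through l \<inter> B. others l p)"
    using sum.Int_Diff[of "through l" "others l" B] by simp
  also have "(\<Sum>p\<in>through l - B. others l p) \<le> (\<Sum>p\<in>through l - B. a)" using out by (intro sum_mono) auto
  also have "(\<Sum>p\<in>through l \<inter> B. others l p) \<le> (\<Sum>p\<in>through l \<inter> B. b + c * of_bool (p \<in> rich l))"
    using ins by (intro sum_mono) auto
  also have "\<dots> = b * (excess l + 2) + c * (\<Sum>p\<in>through l \<inter> B. of_bool (p \<in> rich l))"
    using card_in by (simp add: sum.distrib sum_distrib_left)
  also have "(\<Sum>p\<in>through l \<inter> B. of_bool (p \<in> rich l)) = card (through l \<inter> B \<inter> rich l)"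
    by (simp add: of_bool_def sum.If_cases)
  also have "\<dots> \<le> card (rich l)" by (rule card_mono) auto
  finally have "(\<Sum>p\<in>through l. others l p) \<le> a * (7 - excess l) + (b * (excess l + 2) + c * card (rich l))"
    using card_out by (simp add: mult.commute)
  then show ?thesis using sum_excess_sq_points[OF l] by (simp add: others_def)
qed

lemma others_le_square:
  assumes "p \<in> pts" "l \<in> through p" "(\<Sum>m\<in>through p - {l}. excess m) = S"
  shows "others l p \<le> S * S"
proof -
  have "others l p \<le> (\<Sum>m\<in>through p - {l}. excess m * S)"
    unfolding others_def assms(3)[symmetric] by (intro sum_mono mult_left_mono member_le_sum) auto
  then show ?thesis using assms(3) by (simp add: sum_distrib_right[symmetric])
qed

lemma others_le_mult:
  assumes "\<And>m. m \<in> pts \<Longrightarrow> excess m \<le> c"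
  shows "others l p \<le> c * (\<Sum>m\<in>through p - {l}. excess m)"
  unfolding others_def sum_distrib_left
  by (intro sum_mono mult_right_mono assms) (auto simp: through_def)

lemma contradiction: False
proof -
  have thr: "p \<in> pts" "l \<in> through p" if "l \<in> pts" "p \<in> through l" for p l :: "'k \<times> 'k \<times> 'k"
    using that mem_through_commute[of p l] by (auto simp: through_def)
  have no5: "excess l \<noteq> 5" if l: "l \<in> pts" for l
  proof
    assume e: "excess l = 5"
    \<comment> \<open>Outside \<open>B\<close> the other excesses sum to \<open>5 - 5 = 0\<close>.
      With two rich points the right side is at most \<open>25 + 112 + 32 = 169\<close>.\<close>
    have "177 \<le> excess l * excess l + 0 * (7 - excess l) + 16 * (excess l + 2) + 16 * card (rich l)"
    proof (rule sum_others_le[OF l])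
      fix p assume p: "p \<in> through l"
      { assume "p \<notin> B"
        then show "others l p \<le> 0"
          using sum_excess_others[OF thr[OF l p]] e others_le_square[OF thr[OF l p], of 0] by simp }
      { assume "p \<in> B"
        then show "others l p \<le> 16 + 16 * of_bool (p \<in> rich l)"
          using types_5[OF _ thr(2)[OF l p] e] thr(2)[OF l p] by (auto simp: others_def rich_def) }
    qed
    then show False using card_rich_le[OF l] e by simp
  qed
  then have le4: "excess m \<le> 4" if "m \<in> pts" for m using excess_le_5[OF that] no5[OF that] by simp
  have no4: "excess l \<noteq> 4" if l: "l \<in> pts" for l
  proof
    assume e: "excess l = 4"
    \<comment> \<open>At a point of \<open>B\<close> the other excesses sum to 9, so their squares
      to at most \<open>4 * 9 = 36 = 21 + 15\<close>. The right side is at most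
      \<open>16 + 3 + 126 + 30 = 175\<close>.\<close>
    have "177 \<le> excess l * excess l + 1 * (7 - excess l) + 21 * (excess l + 2) + 15 * card (rich l)"
    proof (rule sum_others_le[OF l])
      fix p assume p: "p \<in> through l"
      { assume "p \<notin> B"
        then show "others l p \<le> 1"
          using sum_excess_others[OF thr[OF l p]] e others_le_square[OF thr[OF l p], of 1] by simp }
      { assume pB: "p \<in> B"
        have "others l p \<le> 36"
          using others_le_mult[of 4 l p] le4 sum_excess_others[OF thr[OF l p]] e pB by simp
        then show "others l p \<le> 21 + 15 * of_bool (p \<in> rich l)"
          using types_4[OF pB thr(2)[OF l p] e le4] thr(2)[OF l p] pB by (auto simp: others_def rich_def) }
    qed
    then show False using card_rich_le[OF l] e by simp
  qed
  then have le3: "excess m \<le> 3" if "m \<in> pts" for m using le4[OF that] no4[OF that] by simp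
  have no3: "excess l \<noteq> 3" if l: "l \<in> pts" for l
  proof
    assume e: "excess l = 3"
    \<comment> \<open>Here \<open>30 = 3 * 10\<close>, and the right side is
      \<open>9 + 16 + 150 = 175\<close>.\<close>
    have "177 \<le> excess l * excess l + 4 * (7 - excess l) + 30 * (excess l + 2) + 0 * card (rich l)"
    proof (rule sum_others_le[OF l])
      fix p assume p: "p \<in> through l"
      { assume "p \<notin> B"
        then show "others l p \<le> 4"
          using sum_excess_others[OF thr[OF l p]] e others_le_square[OF thr[OF l p], of 2] by simp }
      { assume pB: "p \<in> B"
        then show "others l p \<le> 30 + 0 * of_bool (p \<in> rich l)"
          using others_le_mult[of 3 l p] le3 sum_excess_others[OF thr[OF l p]] e by simp }
    qed
    then show False using e by simp
  qed
  \<comment> \<open>With all excesses at most 2, the squares sum to at most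
    \<open>2 * 61 = 122\<close>.\<close>
  have "(\<Sum>l\<in>pts. excess l * excess l) \<le> (\<Sum>l\<in>pts. 2 * excess l)"
  proof (intro sum_mono mult_right_mono)
    fix l :: "'k \<times> 'k \<times> 'k" assume l: "l \<in> pts"
    show "excess l \<le> 2" using le3[OF l] no3[OF l] by simp
  qed simp
  then show False using sum_excess_sq sum_excess by (simp add: sum_distrib_left[symmetric])
qed

end

lemma no_double_blocking_set_23:
  fixes B :: "('k::{field,finite} \<times> 'k \<times> 'k) set"
  assumes "CARD('k) = 8" "B \<subseteq> pts" "card B = 23"
  obtains l where "l \<in> pts" "card {r \<in> B. dot l r = 0} < 2"
  using double_blocking.contradiction[of B] assms unfolding double_blocking_def by (meson not_less)

section \<open>Systems of points in the plane of order 8\<close>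

fun vec3 :: "'k \<times> 'k \<times> 'k \<Rightarrow> 'k vec" where
  "vec3 (x, y, z) = vec_of_list [x, y, z]"

lemma vec3_carrier [simp]: "vec3 p \<in> carrier_vec 3"
  by (cases p) (auto intro!: carrier_vecI)

lemma vec3_scalar_prod: "vec3 l \<bullet> vec3 p = dot l (p :: 'k::field \<times> 'k \<times> 'k)"
  by (cases l; cases p) (simp add: add.assoc)

lemma vec3_surj:
  assumes "v \<in> carrier_vec 3"
  obtains p where "v = vec3 p"
proof
  show "v = vec3 (v $ 0, v $ 1, v $ 2)"
  proof (rule eq_vecI)
    fix i assume "i < dim_vec (vec3 (v $ 0, v $ 1, v $ 2))"
    then have "i = 0 \<or> i = 1 \<or> i = 2" by auto
    then show "v $ i = vec3 (v $ 0, v $ 1, v $ 2) $ i" by (auto simp: numeral_2_eq_2)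
  qed (use assms in auto)
qed

lemma vec3_eq_0_iff: "vec3 p = 0\<^sub>v 3 \<longleftrightarrow> p = (0 :: 'k::field \<times> 'k \<times> 'k)"
proof
  assume 0: "vec3 p = 0\<^sub>v 3"
  obtain x y z where p: "p = (x, y, z)" by (cases p)
  have "vec3 p $ 0 = 0" "vec3 p $ 1 = 0" "vec3 p $ 2 = 0" unfolding 0 by simp_all
  then show "p = 0" by (simp add: p zero_prod_def numeral_2_eq_2)
next
  assume "p = 0"
  then show "vec3 p = 0\<^sub>v 3" by (auto simp: zero_prod_def eq_vecI vec_eq_iff less_Suc_eq numeral_3_eq_3)
qed

definition point_space :: "'k::{field,finite} \<times> 'k \<times> 'k \<Rightarrow> 'k vec set" where
  "point_space p = vspan 3 {vec3 p}"

lemma point_space_subset: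
  "point_space p \<subseteq> orth 3 (vec3 l) \<longleftrightarrow> dot l p = 0"
proof -
  have "vspan 3 {vec3 p} \<subseteq> orth 3 (vec3 l) \<longleftrightarrow> {vec3 p} \<subseteq> orth 3 (vec3 l)"
    by (intro span_subset_iff is_subspace_orth) auto
  then show ?thesis by (simp add: point_space_def orth_def vec3_scalar_prod)
qed

lemma contained_count_points:
  "contained_count (image_mset point_space N) (orth 3 (vec3 l)) = size (filter_mset (\<lambda>p. dot l p = 0) N)"
  by (induction N) (auto simp: contained_count_def point_space_subset)

lemma point_systemI:
  fixes N :: "('k::{field,finite} \<times> 'k \<times> 'k) multiset"
  assumes le: "\<And>l. l \<in> pts \<Longrightarrow> size (filter_mset (\<lambda>p. dot l p = 0) N) \<le> s"
    and eq: "l0 \<in> pts" "size (filter_mset (\<lambda>p. dot l0 p = 0) N) = s"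
  shows "projective_system 1 (size N) 3 s (image_mset point_space N)"
proof (rule projective_systemI)
  fix U assume "U \<in># image_mset point_space N"
  then obtain p where U: "U = vspan 3 {vec3 p}" by (auto simp: point_space_def)
  show "is_subspace 3 U \<and> sdim 3 U \<le> 1"
    unfolding U using is_subspace_span[of "{vec3 p}" 3] sdim_span_le[of "{vec3 p}" 3] by simp
next
  fix w :: "'k vec" assume w: "w \<in> carrier_vec 3" "w \<noteq> 0\<^sub>v 3"
  obtain v where v: "w = vec3 v" by (rule vec3_surj[OF w(1)])
  then have "v \<noteq> 0" using w(2) vec3_eq_0_iff by blast
  then obtain c l where l: "c \<noteq> 0" "l \<in> pts" "v = scale c l" by (rule normalize)
  have "contained_count (image_mset point_space N) (orth 3 w) = size (filter_mset (\<lambda>p. dot v p = 0) N)"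
    unfolding v by (rule contained_count_points)
  also have "\<dots> = size (filter_mset (\<lambda>p. dot l p = 0) N)" using l by (simp add: dot_scale_left)
  finally show "contained_count (image_mset point_space N) (orth 3 w) \<le> s" using le[OF l(2)] by simp
next
  show "vec3 l0 \<noteq> 0\<^sub>v 3" using pts_nonzero[OF eq(1)] vec3_eq_0_iff by blast
  show "contained_count (image_mset point_space N) (orth 3 (vec3 l0)) = s"
    using eq(2) by (simp add: contained_count_points)
qed simp_all

text \<open>Each member is replaced by a point such that every line containing the point contains
  the member; so no count grows.\<close>

lemma point_systemE:
  fixes M :: "'k::{field,finite} vec set multiset"
  assumes M: "projective_system 1 n 3 s M"
  obtains N :: "('k \<times> 'k \<times> 'k) multiset" where "size N = n" "set_mset N \<subseteq> pts"
    "\<And>l. l \<in> pts \<Longrightarrow> size (filter_mset (\<lambda>p. dot l p = 0) N) \<le> s"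
proof -
  have "\<exists>p\<in>pts. \<forall>l. dot l p = 0 \<longrightarrow> U \<subseteq> orth 3 (vec3 l)" if "U \<in># M" for U
  proof -
    have "is_subspace 3 U" "sdim 3 U \<le> 1" using M that by (auto simp: projective_system_def)
    then obtain u where u: "u \<in> carrier_vec 3" "u \<noteq> 0\<^sub>v 3"
      "\<And>w. w \<in> carrier_vec 3 \<Longrightarrow> w \<bullet> u = 0 \<Longrightarrow> U \<subseteq> orth 3 w"
      by (rule dim_le_1_generator) simp_all
    obtain v where v: "u = vec3 v" by (rule vec3_surj[OF u(1)])
    then have "v \<noteq> 0" using u(2) vec3_eq_0_iff by blast
    then obtain c p where p: "c \<noteq> 0" "p \<in> pts" "v = scale c p" by (rule normalize)
    have "U \<subseteq> orth 3 (vec3 l)" if "dot l p = 0" for l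
    proof (rule u(3))
      have "dot v l = c * dot p l" using p by (simp add: dot_scale_left)
      then show "vec3 l \<bullet> u = 0" using that by (simp add: v vec3_scalar_prod dot_commute[of l])
    qed simp
    then show ?thesis using p(2) by blast
  qed
  then obtain f where f: "\<And>U. U \<in># M \<Longrightarrow> f U \<in> pts"
    "\<And>U l. U \<in># M \<Longrightarrow> dot l (f U) = 0 \<Longrightarrow> U \<subseteq> orth 3 (vec3 l)" by metis
  show ?thesis
  proof (rule that[of "image_mset f M"])
    show "size (image_mset f M) = n" using M by (simp add: projective_system_def)
    show "set_mset (image_mset f M) \<subseteq> pts" using f(1) by auto
    fix l :: "'k \<times> 'k \<times> 'k" assume l: "l \<in> pts"
    have "size (filter_mset (\<lambda>p. dot l p = 0) (image_mset f M)) = size (filter_mset (\<lambda>U. dot l (f U) = 0) M)"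
      by (simp add: filter_mset_image_mset)
    also have "\<dots> \<le> size (filter_mset (\<lambda>U. U \<subseteq> orth 3 (vec3 l)) M)"
      using f(2) by (induction M) auto
    also have "\<dots> \<le> s"
    proof -
      have "is_hyperplane 3 (orth 3 (vec3 l))"
        by (rule hyperplane_orth) (use vec3_carrier vec3_eq_0_iff[of l] pts_nonzero[OF l] in blast)+
      then show ?thesis using M unfolding projective_system_def contained_count_def by blast
    qed
    finally show "size (filter_mset (\<lambda>p. dot l p = 0) (image_mset f M)) \<le> s" .
  qed
qed

text \<open>Counting on the \<open>q + 1\<close> lines through a point of multiplicity
  \<open>m\<close> gives \<open>size N + q * m \<le> s * (q + 1)\<close>, which excludes
  \<open>m \<ge> 2\<close>.\<close>

lemma arc_is_set:
  fixes N :: "('k::{field,finite} \<times> 'k \<times> 'k) multiset"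
  assumes N: "set_mset N \<subseteq> pts" and le: "\<And>l. l \<in> pts \<Longrightarrow> size (filter_mset (\<lambda>p. dot l p = 0) N) \<le> s"
    and s: "s * (CARD('k) + 1) < size N + 2 * CARD('k)"
  shows "N = mset_set (set_mset N)"
proof (rule multiset_eqI)
  fix p
  show "count N p = count (mset_set (set_mset N)) p"
  proof (cases "p \<in># N")
    case True
    then have p: "p \<in> pts" using N by auto
    have "size N + CARD('k) * count N p = (\<Sum>l\<in>through p. size (filter_mset (\<lambda>r. dot l r = 0) N))"
      using sum_count_through[OF p N] by simp
    also have "\<dots> \<le> (\<Sum>l\<in>through p. s)" by (intro sum_mono le) (simp add: through_def)
    also have "\<dots> = s * (CARD('k) + 1)" using card_through[OF pts_nonzero[OF p]] by simp
    finally have "CARD('k) * count N p < CARD('k) * 2" using s by linarith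
    then have "count N p < 2" unfolding mult_less_cancel1 by simp
    then show ?thesis using True by (simp add: le_less_Suc_eq numeral_2_eq_2 Suc_le_eq)
  qed (simp add: not_in_iff)
qed

section \<open>The two exact values in the plane of order 8\<close>

lemma n_max_points_8_7:
  assumes k: "CARD('k::{field,finite}) = 8"
  shows "n_max TYPE('k) 3 1 7 = 49"
  unfolding n_max_def
proof (rule Greatest_equality)
  let ?f = "\<lambda>(a, b). (1, a, b) :: 'k \<times> 'k \<times> 'k"
  \<comment> \<open>The \<open>7 * 7\<close> points off the coordinate triangle.\<close>
  define A where "A = ?f ` ((UNIV - {0}) \<times> (UNIV - {0}))"
  have cU: "card (UNIV - {0::'k}) = 7" using k by (simp add: card_Diff_singleton)
  have cA: "card A = 49"
    unfolding A_def using cU by (subst card_image) (auto simp: inj_on_def card_cartesian_product)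
  have line: "card {p \<in> A. dot l p = 0} \<le> 7" if l: "l \<in> pts" for l
  proof -
    obtain u v w where uvw: "l = (u, v, w)" by (cases l)
    consider "w \<noteq> 0" | "w = 0" "v \<noteq> 0" | "w = 0" "v = 0" "u \<noteq> 0"
      using pts_nonzero[OF l] uvw by (auto simp: zero_prod_def)
    then show ?thesis
    proof cases
      case 1
      have "{p \<in> A. dot l p = 0} \<subseteq> (\<lambda>a. (1, a, - (u + v * a) / w)) ` (UNIV - {0})"
      proof
        fix p assume "p \<in> {p \<in> A. dot l p = 0}"
        then obtain a b where p: "p = (1, a, b)" "a \<noteq> 0" "u + v * a + w * b = 0" by (auto simp: A_def uvw)
        then have "b = - (u + v * a) / w" using 1 by (simp add: field_simps add_eq_0_iff)
        then show "p \<in> (\<lambda>a. (1, a, - (u + v * a) / w)) ` (UNIV - {0})" using p by blast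
      qed
      then show ?thesis using surj_card_le[of "UNIV - {0::'k}"] cU by fastforce
    next
      case 2
      have "{p \<in> A. dot l p = 0} \<subseteq> (\<lambda>b. (1, - u / v, b)) ` (UNIV - {0})"
      proof
        fix p assume "p \<in> {p \<in> A. dot l p = 0}"
        then obtain a b where p: "p = (1, a, b)" "b \<noteq> 0" "dot l p = 0" by (auto simp: A_def)
        then have "a = - u / v" using 2 by (simp add: uvw field_simps add_eq_0_iff)
        then show "p \<in> (\<lambda>b. (1, - u / v, b)) ` (UNIV - {0})" using p by blast
      qed
      then show ?thesis using surj_card_le[of "UNIV - {0::'k}"] cU by fastforce
    next
      case 3
      then have "{p \<in> A. dot l p = 0} = {}" by (auto simp: A_def uvw)
      then show ?thesis by (metis card.empty zero_le)
    qed
  qed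
  \<comment> \<open>A line through a vertex of the triangle, not a side, contains 7 of the
    points.\<close>
  have "{p \<in> A. dot (0, 1, -1) p = 0} = (\<lambda>a. (1, a, a)) ` (UNIV - {0})" by (auto simp: A_def)
  then have "card {p \<in> A. dot (0, 1, -1) p = 0} = 7"
    using cU by (simp add: card_image inj_on_def)
  then have "projective_system 1 (size (mset_set A)) 3 7 (image_mset point_space (mset_set A))"
    using line by (intro point_systemI[of _ _ "(0, 1, -1)"]) (auto simp: filter_mset_mset_set pts_def)
  then show "\<exists>M :: 'k vec set multiset. projective_system 1 49 3 7 M" using cA by (auto simp: size_mset_set)
next
  fix n assume "\<exists>M :: 'k vec set multiset. projective_system 1 n 3 7 M"
  then obtain M :: "'k vec set multiset" where "projective_system 1 n 3 7 M" by blast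
  then obtain N :: "('k \<times> 'k \<times> 'k) multiset" where N: "size N = n" "set_mset N \<subseteq> pts"
    "\<And>l. l \<in> pts \<Longrightarrow> size (filter_mset (\<lambda>p. dot l p = 0) N) \<le> 7"
    by (rule point_systemE) blast
  show "n \<le> 49"
  proof (rule ccontr)
    assume n: "\<not> n \<le> 49"
    have eq: "N = mset_set (set_mset N)" by (rule arc_is_set[OF N(2,3)]) (use n N(1) k in simp_all)
    have "n = card (set_mset N)" using eq N(1) by (metis size_mset_set)
    then have "50 \<le> card (set_mset N)" using n by simp
    \<comment> \<open>With exactly 50 points, the complement has \<open>73 - 50 = 23\<close>. A line
      with at most one point in it has at least 8 points in \<open>T\<close>, contradicting the
      bound 7.\<close>
    then obtain T where T: "T \<subseteq> set_mset N" "card T = 50" by (rule obtain_subset_with_card_n)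
    have "card (pts - T) = 23"
      using T N(2) k card_pts[where 'k = 'k] by (subst card_Diff_subset) (auto intro: finite_subset)
    then obtain l where l: "l \<in> pts" "card {r \<in> pts - T. dot l r = 0} < 2"
      using no_double_blocking_set_23[OF k, of "pts - T"] by blast
    have th: "through l = {r \<in> pts - T. dot l r = 0} \<union> {r \<in> T. dot l r = 0}"
      using T N(2) by (auto simp: through_def dot_commute)
    have "card (through l) \<le> card {r \<in> pts - T. dot l r = 0} + card {r \<in> T. dot l r = 0}"
      unfolding th by (rule card_Un_le)
    moreover have "card (through l) = 9" using card_through[OF pts_nonzero[OF l(1)]] k by simp
    moreover have "card {r \<in> T. dot l r = 0} \<le> card {r \<in> set_mset N. dot l r = 0}"
      using T(1) by (intro card_mono) auto
    moreover have "card {r \<in> set_mset N. dot l r = 0} \<le> 7"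
      using N(3)[OF l(1)] by (subst (asm) eq) (simp add: filter_mset_mset_set)
    ultimately show False using l(2) by simp
  qed
qed

lemma n_max_points_8_10:
  assumes k: "CARD('k::{field,finite}) = 8"
  shows "n_max TYPE('k) 3 1 10 = 74"
  unfolding n_max_def
proof (rule Greatest_equality)
  \<comment> \<open>All 73 points, one of them doubled: a line has 9 points, or 10 if it passes
    through the doubled one.\<close>
  let ?N = "add_mset (0, 0, 1) (mset_set (pts :: ('k \<times> 'k \<times> 'k) set))"
  have 9: "card {p \<in> pts. dot l p = 0} = 9" if "l \<in> pts" for l :: "'k \<times> 'k \<times> 'k"
    using card_through[OF pts_nonzero[OF that]] k by (simp add: through_def dot_commute)
  have N: "size (filter_mset (\<lambda>p. dot l p = 0) ?N) = of_bool (dot l (0, 0, 1) = 0) + 9" if "l \<in> pts" for l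
    using 9[OF that] by (simp add: filter_mset_mset_set)
  have "projective_system 1 (size ?N) 3 10 (image_mset point_space ?N)"
  proof (rule point_systemI)
    show l0: "(1, 0, 0) \<in> pts" by (auto simp: pts_def)
    show "size (filter_mset (\<lambda>p. dot (1, 0, 0) p = 0) ?N) = 10" unfolding N[OF l0] by simp
    show "size (filter_mset (\<lambda>p. dot l p = 0) ?N) \<le> 10" if "l \<in> pts" for l unfolding N[OF that] by simp
  qed
  moreover have "size ?N = 74" using card_pts[where 'k = 'k] k by simp
  ultimately show "\<exists>M :: 'k vec set multiset. projective_system 1 74 3 10 M" by metis
next
  fix n assume "\<exists>M :: 'k vec set multiset. projective_system 1 n 3 10 M"
  then obtain M :: "'k vec set multiset" where "projective_system 1 n 3 10 M" by blast
  then obtain N :: "('k \<times> 'k \<times> 'k) multiset" where N: "size N = n" "set_mset N \<subseteq> pts"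
    "\<And>l. l \<in> pts \<Longrightarrow> size (filter_mset (\<lambda>p. dot l p = 0) N) \<le> 10"
    by (rule point_systemE) blast
  show "n \<le> 74"
  proof (rule ccontr)
    assume n: "\<not> n \<le> 74"
    \<comment> \<open>From 75 points on, \<open>10 * 9 = 90 < n + 16\<close>, so no point is
      repeated.\<close>
    have eq: "N = mset_set (set_mset N)" by (rule arc_is_set[OF N(2,3)]) (use n N(1) k in simp_all)
    have "n = card (set_mset N)" using eq N(1) by (metis size_mset_set)
    also have "\<dots> \<le> card (pts :: ('k \<times> 'k \<times> 'k) set)" using N(2) by (intro card_mono) auto
    finally show False using card_pts[where 'k = 'k] k n by simp
  qed
qed

theorem theorem8:
  assumes "CARD('f::{field,finite}) = 2"
    and "CARD('k::{field,finite}) = 2 ^ 3"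
  shows "(n_max TYPE('f) 9 3 7 \<ge> 51 \<and> (51::nat) > 49 \<and> 49 = n_bar TYPE('k) 9 3 7) \<and>
         (n_max TYPE('f) 9 3 10 \<ge> 76 \<and> (76::nat) > 74 \<and> 74 = n_bar TYPE('k) 9 3 10)"
proof -
  have k: "CARD('k) = 8" using assms(2) by simp
  have bar: "n_bar TYPE('k) 9 3 s = n_max TYPE('k) 3 1 s" for s by (simp add: n_bar_def)
  have "51 \<le> n_max TYPE('f) 9 3 7" by (rule n_max_ge[OF system51[OF assms(1)]]) simp
  moreover have "76 \<le> n_max TYPE('f) 9 3 10" by (rule n_max_ge[OF system76[OF assms(1)]]) simp
  ultimately show ?thesis unfolding bar n_max_points_8_7[OF k] n_max_points_8_10[OF k] by simp
qed

end
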